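(* Let $\mathcal{A}=A\oplus P$ be a diolic algebra over $\mathbb{K}$, with $D(\mathcal{A})_0$ identified with the $A$-module $\mathrm{Der}(P)$ of Der-operators in $P$. Then the degree $1$ diolic de Rham complex of $\mathcal{A}$ coincides with the Der-complex of the $A$-module $P$, $$0\to P\xrightarrow{\partial^0}\operatorname{Hom}_A(\mathrm{Der}(P),P)\xrightarrow{\partial^1}\cdots\to \mathrm{Alt}_A^i(\mathrm{Der}(P),P)\xrightarrow{\partial^i}\mathrm{Alt}_A^{i+1}(\mathrm{Der}(P),P)\to\cdots,$$ where $\partial^0 p(\Delta)=\Delta(p)$ and, for $\omega\in\mathrm{Alt}_A^k(\mathrm{Der}(P),P)$ and $\Delta_1,\dots,\Delta_{k+1}\in\mathrm{Der}(P)$, $$\partial^k\omega(\Delta_1,\dots,\Delta_{k+1})=\sum_{i=1}^{k+1}(-1)^{i-1}\Delta_i\big(\omega(\Delta_1,\dots,\widehat{\Delta_i},\dots,\Delta_{k+1})\big)+\sum_{i<j}(-1)^{i+j}\omega\big([\Delta_i,\Delta_j],\Delta_1,\dots,\widehat{\Delta_i},\dots,\widehat{\Delta_j},\dots,\Delta_{k+1}\big).$$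
   Context: $\mathbb{K}$ is a field of characteristic $0$. A diolic algebra is a $\mathbb{Z}$-graded commutative $\mathbb{K}$-algebra $\mathcal{A}=\mathcal{A}_0\oplus\mathcal{A}_1$ with $\mathcal{A}_0=A$ a commutative unital $\mathbb{K}$-algebra, $\mathcal{A}_1=P$ an $A$-module, $\mathcal{A}_i=0$ for $i\ne 0,1$; the products are the multiplication of $A$, the module action $A\cdot P\subseteq P$, and $P\cdot P=0$. A Der-operator in $P$ is a $\mathbb{K}$-linear map $\Delta:P\to P$ for which there is a derivation $X\in D(A)$ (its symbol) with $\Delta(ap)=X(a)p+a\Delta(p)$; Der-operators form the $A$-module and Lie algebra $\mathrm{Der}(P)$. Graded derivations of degree $0$ of $\mathcal{A}$ are pairs $(X^A,X^P)$ with $X^A\in D(A)$ and $X^P$ a Der-operator with symbol $X^A$; throughout this setting $D(\mathcal{A})_0$ is identified with $\mathrm{Der}(P)$ (the paper fixes a splitting of the Atiyah sequence $0\to\mathrm{End}_A(P)\to D(\mathcal{A})_0\to D(A)\to 0$ to do so). Degree $1$ diolic de Rham complex: diolic differential $k$-forms of degree $g$ ($g=0,1$) are identified with alternating $A$-multilinear maps $\bigwedge^kD(\mathcal{A})_0\to\mathcal{A}_g$ (so $0$-forms of degree $1$ are the elements of $P=\mathcal{A}_1$). The degree $1$ complex is obtained by restricting the de Rham differential $d$ of $\mathcal{A}$ to the homogeneous component $\mathcal{A}_1=P$, $dp(\Delta)=\Delta(p)$, and extending to higher forms by the graded Leibniz rule, i.e. by the usual de Rham (Cartan) formula for alternating maps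 on $D(\mathcal{A})_0$. $\mathrm{Alt}^k_A(\mathrm{Der}(P),P)=\operatorname{Hom}_A(\bigwedge^k\mathrm{Der}(P),P)$ is the module of alternating $A$-multilinear maps $\mathrm{Der}(P)^k\to P$ ("fat $k$-forms"). *)

theory Defs
  imports Complex_Main "HOL-Library.Function_Algebras" "HOL-Library.Product_Plus"
begin

text \<open>
  The algebra \<open>A\<close> and the module \<open>P\<close> are the types \<open>'a\<close> and \<open>'p\<close>; \<open>sK\<close> is the scalar
  multiplication of \<open>A\<close> by the ground field and \<open>act\<close> is the action of \<open>A\<close> on \<open>P\<close>.
  The ground field acts on \<open>P\<close> through \<open>A\<close>.
\<close>

locale diolic_algebra =
  vector_space sK + P: module act
  for sK :: "'k::field_char_0 \<Rightarrow> 'a::comm_ring_1 \<Rightarrow> 'a"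
    and act :: "'a \<Rightarrow> 'p::ab_group_add \<Rightarrow> 'p" +
  assumes scale_mult: "sK c (a * b) = sK c a * b"

definition scaleP :: "('k \<Rightarrow> 'a::comm_ring_1 \<Rightarrow> 'a) \<Rightarrow> ('a \<Rightarrow> 'p \<Rightarrow> 'p) \<Rightarrow> 'k \<Rightarrow> 'p \<Rightarrow> 'p" where
  "scaleP sK act c p = act (sK c 1) p"


subsection \<open>Derivations of the algebra and Der-operators of the module\<close>

definition derivations :: "('k::field_char_0 \<Rightarrow> 'a::comm_ring_1 \<Rightarrow> 'a) \<Rightarrow> ('a \<Rightarrow> 'a) set" where
  "derivations sK =
     {X. Vector_Spaces.linear sK sK X \<and> (\<forall>a b. X (a * b) = X a * b + a * X b)}"

definition Der :: "('k::field_char_0 \<Rightarrow> 'a::comm_ring_1 \<Rightarrow> 'a) \<Rightarrow>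
    ('a \<Rightarrow> 'p::ab_group_add \<Rightarrow> 'p) \<Rightarrow> ('p \<Rightarrow> 'p) set" where
  "Der sK act =
     {\<Delta>. Vector_Spaces.linear (scaleP sK act) (scaleP sK act) \<Delta> \<and>
         (\<exists>X\<in>derivations sK. \<forall>a p. \<Delta> (act a p) = act (X a) p + act a (\<Delta> p))}"

definition Der_scale :: "('a \<Rightarrow> 'p \<Rightarrow> 'p) \<Rightarrow> 'a \<Rightarrow> ('p \<Rightarrow> 'p) \<Rightarrow> 'p \<Rightarrow> 'p" where
  "Der_scale act a \<Delta> = (\<lambda>p. act a (\<Delta> p))"

definition commutator :: "('v \<Rightarrow> 'v) \<Rightarrow> ('v \<Rightarrow> 'v) \<Rightarrow> 'v \<Rightarrow> 'v::ab_group_add" where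
  "commutator X Y = (\<lambda>v. X (Y v) - Y (X v))"


subsection \<open>The diolic algebra as a graded algebra, and its derivations of degree 0\<close>

text \<open>The underlying module of the diolic algebra is the product type \<open>'a \<times> 'p\<close>.\<close>

definition diolic_mult :: "('a::comm_ring_1 \<Rightarrow> 'p::ab_group_add \<Rightarrow> 'p) \<Rightarrow>
    'a \<times> 'p \<Rightarrow> 'a \<times> 'p \<Rightarrow> 'a \<times> 'p" where
  "diolic_mult act u v = (fst u * fst v, act (fst u) (snd v) + act (fst v) (snd u))"

definition diolic_scaleK :: "('k \<Rightarrow> 'a::comm_ring_1 \<Rightarrow> 'a) \<Rightarrow> ('a \<Rightarrow> 'p \<Rightarrow> 'p) \<Rightarrow>
    'k \<Rightarrow> 'a \<times> 'p \<Rightarrow> 'a \<times> 'p" where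
  "diolic_scaleK sK act c u = (sK c (fst u), scaleP sK act c (snd u))"

definition diolic_scale :: "('a::comm_ring_1 \<Rightarrow> 'p::ab_group_add \<Rightarrow> 'p) \<Rightarrow>
    'a \<Rightarrow> 'a \<times> 'p \<Rightarrow> 'a \<times> 'p" where
  "diolic_scale act a u = diolic_mult act (a, 0) u"

definition diolic_comp :: "int \<Rightarrow> ('a::comm_ring_1 \<times> 'p::ab_group_add) set" where
  "diolic_comp i =
     (if i = 0 then UNIV \<times> {0} else if i = 1 then {0} \<times> UNIV else {0})"

definition diolic_der0 :: "('k::field_char_0 \<Rightarrow> 'a::comm_ring_1 \<Rightarrow> 'a) \<Rightarrow>
    ('a \<Rightarrow> 'p::ab_group_add \<Rightarrow> 'p) \<Rightarrow> ('a \<times> 'p \<Rightarrow> 'a \<times> 'p) set" where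
  "diolic_der0 sK act =
     {X. Vector_Spaces.linear (diolic_scaleK sK act) (diolic_scaleK sK act) X \<and>
         (\<forall>i. X ` diolic_comp i \<subseteq> diolic_comp i) \<and>
         (\<forall>u v. X (diolic_mult act u v) =
                 diolic_mult act (X u) v + diolic_mult act u (X v))}"

definition diolic_der0_scale :: "('a::comm_ring_1 \<Rightarrow> 'p::ab_group_add \<Rightarrow> 'p) \<Rightarrow>
    'a \<Rightarrow> ('a \<times> 'p \<Rightarrow> 'a \<times> 'p) \<Rightarrow> 'a \<times> 'p \<Rightarrow> 'a \<times> 'p" where
  "diolic_der0_scale act a X = (\<lambda>u. diolic_scale act a (X u))"

text \<open>
  The canonical map from derivations of degree 0 to Der-operators: viewing a derivation as a
  pair \<open>(X\<^sup>A, X\<^sup>P)\<close>, it returns \<open>X\<^sup>P\<close>.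
\<close>

definition to_Der :: "('a::comm_ring_1 \<times> 'p \<Rightarrow> 'a \<times> 'p) \<Rightarrow> 'p \<Rightarrow> 'p" where
  "to_Der X = (\<lambda>p. snd (X (0, p)))"


subsection \<open>Alternating multilinear maps and the Cartan formula\<close>

text \<open>
  A \<open>k\<close>-linear map on a set \<open>D\<close> closed under addition and \<open>scD\<close> is a function on lists; it is
  normalised to vanish outside the lists of length \<open>k\<close> over \<open>D\<close>, so that equality of functions
  is equality of forms.
\<close>

definition tuples :: "'d set \<Rightarrow> nat \<Rightarrow> 'd list set" where
  "tuples D k = {xs. length xs = k \<and> set xs \<subseteq> D}"

definition alt_forms :: "'d::plus set \<Rightarrow> ('a \<Rightarrow> 'd \<Rightarrow> 'd) \<Rightarrow>
    'v::ab_group_add set \<Rightarrow> ('a \<Rightarrow> 'v \<Rightarrow> 'v) \<Rightarrow> nat \<Rightarrow> ('d list \<Rightarrow> 'v) set" where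
  "alt_forms D scD V scV k =
     {\<omega>. (\<forall>xs\<in>tuples D k. \<omega> xs \<in> V) \<and>
         (\<forall>xs. xs \<notin> tuples D k \<longrightarrow> \<omega> xs = 0) \<and>
         (\<forall>xs\<in>tuples D k. \<forall>i<k. \<forall>x\<in>D. \<forall>y\<in>D.
            \<omega> (xs[i := x + y]) = \<omega> (xs[i := x]) + \<omega> (xs[i := y])) \<and>
         (\<forall>xs\<in>tuples D k. \<forall>i<k. \<forall>x\<in>D. \<forall>a.
            \<omega> (xs[i := scD a x]) = scV a (\<omega> (xs[i := x]))) \<and>
         (\<forall>xs\<in>tuples D k. \<forall>i j. i < j \<longrightarrow> j < k \<longrightarrow> xs ! i = xs ! j \<longrightarrow> \<omega> xs = 0)}"

definition signed :: "nat \<Rightarrow> 'v \<Rightarrow> 'v::ab_group_add" where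
  "signed n v = (if even n then v else - v)"

text \<open>
  Operators in \<open>D\<close> act on \<open>'v\<close> by application. List positions count from 0, which turns the
  usual sign \<open>(-1)\<^bsup>i-1\<^esup>\<close> into \<open>(-1)\<^bsup>i\<^esup>\<close> and leaves the parity of \<open>i + j\<close> unchanged; \<open>nths xs (- I)\<close>
  omits the positions in \<open>I\<close>.
\<close>

definition cartan_d :: "('v \<Rightarrow> 'v) set \<Rightarrow> nat \<Rightarrow>
    (('v \<Rightarrow> 'v) list \<Rightarrow> 'v) \<Rightarrow> ('v \<Rightarrow> 'v) list \<Rightarrow> 'v::ab_group_add" where
  "cartan_d D k \<omega> xs =
     (if xs \<in> tuples D (Suc k) then
        (\<Sum>i<Suc k. signed i ((xs ! i) (\<omega> (nths xs (- {i}))))) +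
        (\<Sum>j<Suc k. \<Sum>i<j.
           signed (i + j) (\<omega> (commutator (xs ! i) (xs ! j) # nths xs (- {i, j}))))
      else 0)"

definition zero_form :: "'v \<Rightarrow> 'd list \<Rightarrow> 'v::zero" where
  "zero_form v xs = (if xs = [] then v else 0)"


subsection \<open>The two complexes\<close>

definition diolic_forms :: "('k::field_char_0 \<Rightarrow> 'a::comm_ring_1 \<Rightarrow> 'a) \<Rightarrow>
    ('a \<Rightarrow> 'p::ab_group_add \<Rightarrow> 'p) \<Rightarrow> int \<Rightarrow> nat \<Rightarrow>
    (('a \<times> 'p \<Rightarrow> 'a \<times> 'p) list \<Rightarrow> 'a \<times> 'p) set" where
  "diolic_forms sK act g k =
     alt_forms (diolic_der0 sK act) (diolic_der0_scale act)
       (diolic_comp g) (diolic_scale act) k"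

definition diolic_d :: "('k::field_char_0 \<Rightarrow> 'a::comm_ring_1 \<Rightarrow> 'a) \<Rightarrow>
    ('a \<Rightarrow> 'p::ab_group_add \<Rightarrow> 'p) \<Rightarrow> nat \<Rightarrow>
    (('a \<times> 'p \<Rightarrow> 'a \<times> 'p) list \<Rightarrow> 'a \<times> 'p) \<Rightarrow>
    ('a \<times> 'p \<Rightarrow> 'a \<times> 'p) list \<Rightarrow> 'a \<times> 'p" where
  "diolic_d sK act k = cartan_d (diolic_der0 sK act) k"

definition fat_forms :: "('k::field_char_0 \<Rightarrow> 'a::comm_ring_1 \<Rightarrow> 'a) \<Rightarrow>
    ('a \<Rightarrow> 'p::ab_group_add \<Rightarrow> 'p) \<Rightarrow> nat \<Rightarrow> (('p \<Rightarrow> 'p) list \<Rightarrow> 'p) set" where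
  "fat_forms sK act k = alt_forms (Der sK act) (Der_scale act) UNIV act k"

definition Der_d :: "('k::field_char_0 \<Rightarrow> 'a::comm_ring_1 \<Rightarrow> 'a) \<Rightarrow>
    ('a \<Rightarrow> 'p::ab_group_add \<Rightarrow> 'p) \<Rightarrow> nat \<Rightarrow>
    (('p \<Rightarrow> 'p) list \<Rightarrow> 'p) \<Rightarrow> ('p \<Rightarrow> 'p) list \<Rightarrow> 'p" where
  "Der_d sK act k = cartan_d (Der sK act) k"

text \<open>
  A fat form read as a diolic form of degree 1, along \<^const>\<open>to_Der\<close> and the inclusion of
  \<open>P\<close> as the component of degree 1.
\<close>

definition fat_to_diolic :: "('k::field_char_0 \<Rightarrow> 'a::comm_ring_1 \<Rightarrow> 'a) \<Rightarrow>
    ('a \<Rightarrow> 'p::ab_group_add \<Rightarrow> 'p) \<Rightarrow> nat \<Rightarrow>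
    (('p \<Rightarrow> 'p) list \<Rightarrow> 'p) \<Rightarrow> ('a \<times> 'p \<Rightarrow> 'a \<times> 'p) list \<Rightarrow> 'a \<times> 'p" where
  "fat_to_diolic sK act k \<omega> Xs =
     (if Xs \<in> tuples (diolic_der0 sK act) k then (0, \<omega> (map to_Der Xs)) else 0)"

end

theory Submission
  imports Defs
begin

text \<open>
  A derivation of degree 0 of the diolic algebra splits into a derivation of \<open>A\<close> and a Der-operator
  of which it is the symbol, so \<^const>\<open>to_Der\<close> maps onto the Der-operators
  (\<open>diolic_der0_cases\<close>, \<open>map_prod_in_diolic_der0\<close>). It preserves sums, multiples and commutators, and
  it is injective by hypothesis. A derivation acts on \<open>P\<close> exactly as its Der-operator does. Therefore the
  two modules of forms correspond to each other (\<open>fat_to_diolic_inj\<close>, \<open>fat_to_diolic_surj\<close>), and the two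
  Cartan formulas, being written in terms of the action and the commutator alone, agree
  (\<open>diolic_d_fat_to_diolic\<close>). It remains to see that one of the two, the Der-complex, is a complex of
  modules of forms.

  This part is the Cartan calculus of a Lie algebra \<open>D\<close> of operators on \<open>P\<close> which is also an
  \<open>A\<close>-module. Writing \<open>\<iota>\<^sub>x\<close> for the contraction with \<open>x\<close>, the Lie derivative \<open>L\<^sub>X\<close> and the differential
  \<open>d\<close> are defined by recursion on the list of arguments from
  \<open>\<iota>\<^sub>z L\<^sub>X = L\<^sub>X \<iota>\<^sub>z - \<iota>\<^bsub>[X,z]\<^esub>\<close> and \<open>\<iota>\<^sub>x d = L\<^sub>x - d \<iota>\<^sub>x\<close>. Forms are described by the same
  recursion, through properties of their contractions. In this language the statements that need lengthy
  bookkeeping with the explicit sums become short inductions: \<open>L\<^sub>X\<close> and \<open>d\<close> preserve forms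
  (\<open>is_form_lie\<close>, \<open>is_form_ext_d\<close>), \<open>L\<close> represents the commutator (\<open>lie_lie\<close>), \<open>L\<^sub>X\<close> commutes with
  \<open>d\<close> (\<open>lie_ext_d\<close>), and \<open>d d = 0\<close> (\<open>ext_d_ext_d\<close>). The explicit Cartan formula satisfies the
  recursion that defines \<open>d\<close> (\<open>lie_eq_sum\<close>, \<open>cartan_sum_eq_ext_d\<close>); signs are tracked through
  sums only in that comparison.
\<close>

section \<open>Contraction, tuples and signs\<close>

definition contract :: "'d \<Rightarrow> ('d list \<Rightarrow> 'v) \<Rightarrow> 'd list \<Rightarrow> 'v" where
  "contract x \<omega> = (\<lambda>xs. \<omega> (x # xs))"

lemma contract_apply [simp]: "contract x \<omega> xs = \<omega> (x # xs)"
  by (simp add: contract_def)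

lemma contract_add_right [simp]: "contract x (\<omega> + \<eta>) = contract x \<omega> + contract x \<eta>"
  by (simp add: fun_eq_iff)

lemma contract_diff_right [simp]:
  fixes \<omega> :: "'d list \<Rightarrow> 'v::ab_group_add"
  shows "contract x (\<omega> - \<eta>) = contract x \<omega> - contract x \<eta>"
  by (simp add: fun_eq_iff)

lemma contract_zero_right [simp]: "contract x 0 = 0"
  by (simp add: fun_eq_iff)

lemma tuples_Cons: "x # xs \<in> tuples D (Suc k) \<longleftrightarrow> x \<in> D \<and> xs \<in> tuples D k"
  by (auto simp: tuples_def)

lemma alt_formsI:
  assumes "\<And>xs. xs \<in> tuples D k \<Longrightarrow> \<omega> xs \<in> V"
    and "\<And>xs. xs \<notin> tuples D k \<Longrightarrow> \<omega> xs = 0"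
    and "\<And>xs i x y. \<lbrakk>xs \<in> tuples D k; i < k; x \<in> D; y \<in> D\<rbrakk>
      \<Longrightarrow> \<omega> (xs[i := x + y]) = \<omega> (xs[i := x]) + \<omega> (xs[i := y])"
    and "\<And>xs i x a. \<lbrakk>xs \<in> tuples D k; i < k; x \<in> D\<rbrakk>
      \<Longrightarrow> \<omega> (xs[i := scD a x]) = scV a (\<omega> (xs[i := x]))"
    and "\<And>xs i j. \<lbrakk>xs \<in> tuples D k; i < j; j < k; xs ! i = xs ! j\<rbrakk> \<Longrightarrow> \<omega> xs = 0"
  shows "\<omega> \<in> alt_forms D scD V scV k"
  using assms unfolding alt_forms_def by blast

lemma alt_formsD:
  assumes "\<omega> \<in> alt_forms D scD V scV k"
  shows "\<And>xs. xs \<in> tuples D k \<Longrightarrow> \<omega> xs \<in> V"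
    and "\<And>xs. xs \<notin> tuples D k \<Longrightarrow> \<omega> xs = 0"
    and "\<And>xs i x y. \<lbrakk>xs \<in> tuples D k; i < k; x \<in> D; y \<in> D\<rbrakk>
      \<Longrightarrow> \<omega> (xs[i := x + y]) = \<omega> (xs[i := x]) + \<omega> (xs[i := y])"
    and "\<And>xs i x a. \<lbrakk>xs \<in> tuples D k; i < k; x \<in> D\<rbrakk>
      \<Longrightarrow> \<omega> (xs[i := scD a x]) = scV a (\<omega> (xs[i := x]))"
    and "\<And>xs i j. \<lbrakk>xs \<in> tuples D k; i < j; j < k; xs ! i = xs ! j\<rbrakk> \<Longrightarrow> \<omega> xs = 0"
  using assms unfolding alt_forms_def by blast+

lemma signed_Suc: "signed (Suc n) v = - signed n (v::'v::ab_group_add)"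
  by (simp add: signed_def)

lemma signed_minus: "signed n (- v) = - signed n (v::'v::ab_group_add)"
  by (simp add: signed_def)

lemma signed_0 [simp]: "signed 0 v = v"
  by (simp add: signed_def)

lemma nths_Compl_0: "nths (x # xs) (- {0}) = xs"
  by (simp add: nths_Cons nths_all)

lemma nths_Compl_Suc: "nths (x # xs) (- {Suc i}) = x # nths xs (- {i})"
proof -
  have "{j. Suc j \<in> - {Suc i}} = - {i}" by auto
  then show ?thesis by (simp only: nths_Cons) simp
qed

lemma nths_Compl_0_Suc: "nths (x # xs) (- {0, Suc i}) = nths xs (- {i})"
proof -
  have "{j. Suc j \<in> - {0, Suc i}} = - {i}" by auto
  then show ?thesis by (simp only: nths_Cons) simp
qed

lemma nths_Compl_Suc_Suc: "nths (x # xs) (- {Suc i, Suc j}) = x # nths xs (- {i, j})"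
proof -
  have "{l. Suc l \<in> - {Suc i, Suc j}} = - {i, j}" by auto
  then show ?thesis by (simp only: nths_Cons) simp
qed

section \<open>Lie modules of operators\<close>

text \<open>
  Both complexes are built from a Lie algebra of operators that is at the same time a module
  over the coefficient ring. These are the only properties of the Der-operators that the Cartan
  calculus uses: the symbol of an operator enters as an arbitrary map \<open>\<sigma>\<close>; its values always
  cancel between the action on a value and the commutator with an argument.
\<close>

locale der_operators = module act
  for act :: "'a::comm_ring_1 \<Rightarrow> 'p::ab_group_add \<Rightarrow> 'p" +
  fixes D :: "('p \<Rightarrow> 'p) set"
  assumes D_add: "\<lbrakk>X \<in> D; Y \<in> D\<rbrakk> \<Longrightarrow> X + Y \<in> D"
    and D_scale: "X \<in> D \<Longrightarrow> Der_scale act a X \<in> D"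
    and D_commutator: "\<lbrakk>X \<in> D; Y \<in> D\<rbrakk> \<Longrightarrow> commutator X Y \<in> D"
    and D_additive: "X \<in> D \<Longrightarrow> X (p + q) = X p + X q"
    and D_symbol: "X \<in> D \<Longrightarrow> \<exists>\<sigma>. \<forall>a p. X (act a p) = act (\<sigma> a) p + act a (X p)"
begin

lemma D_zero: "X \<in> D \<Longrightarrow> X 0 = 0"
  using D_additive[of X 0 0] by simp

lemma D_minus: "X \<in> D \<Longrightarrow> X (- p) = - X p"
  using D_additive[of X p "- p"] D_zero[of X] by (simp add: eq_neg_iff_add_eq_0 add.commute)

lemma D_apply_diff: "X \<in> D \<Longrightarrow> X (p - q) = X p - X q"
  using D_additive[of X p "- q"] D_minus[of X q] by simp

lemma diff_eq_add_scale: "X - Y = X + Der_scale act (- 1) Y"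
  by (simp add: fun_eq_iff Der_scale_def)

lemma commutator_add_left:
  "z \<in> D \<Longrightarrow> commutator (X + Y) z = commutator X z + commutator Y z"
  by (simp add: fun_eq_iff commutator_def D_additive)

lemma commutator_add_right:
  "X \<in> D \<Longrightarrow> commutator X (y + z) = commutator X y + commutator X z"
  by (simp add: fun_eq_iff commutator_def D_additive)

lemma commutator_jacobi:
  assumes "X \<in> D" "Y \<in> D" "Z \<in> D"
  shows "commutator (commutator X Y) Z = commutator X (commutator Y Z) - commutator Y (commutator X Z)"
  using assms by (simp add: fun_eq_iff commutator_def D_apply_diff)

section \<open>Forms described by their contractions\<close>

definition form_scale :: "'a \<Rightarrow> ('d list \<Rightarrow> 'p) \<Rightarrow> 'd list \<Rightarrow> 'p" where
  "form_scale a \<omega> = (\<lambda>xs. act a (\<omega> xs))"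

lemma form_scale_apply [simp]: "form_scale a \<omega> xs = act a (\<omega> xs)"
  by (simp add: form_scale_def)

lemma form_scale_zero [simp]: "form_scale a 0 = 0"
  by (simp add: fun_eq_iff)

lemma form_scale_add: "form_scale a (\<omega> + \<eta>) = form_scale a \<omega> + form_scale a \<eta>"
  by (simp add: fun_eq_iff scale_right_distrib)

lemma form_scale_commute: "form_scale a (form_scale b \<omega>) = form_scale b (form_scale a \<omega>)"
  by (simp add: fun_eq_iff mult.commute)

lemma contract_form_scale [simp]: "contract x (form_scale a \<omega>) = form_scale a (contract x \<omega>)"
  by (simp add: fun_eq_iff)

lemma form_diff_eq_add_scale: "\<omega> - \<eta> = \<omega> + form_scale (- 1) \<eta>"
  by (simp add: fun_eq_iff)

text \<open>
  A form of degree \<open>Suc k\<close> is determined by its contractions, which are forms of degree \<open>k\<close>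
  depending linearly on the contracted operator. It is alternating as soon as contracting
  twice with the same operator gives zero: transpositions of adjacent arguments produce all others.
  This recursive description avoids every index and makes each identity below an induction in which
  the induction hypothesis is applied to a contraction.
\<close>

primrec is_form :: "nat \<Rightarrow> (('p \<Rightarrow> 'p) list \<Rightarrow> 'p) \<Rightarrow> bool" where
  "is_form 0 \<omega> \<longleftrightarrow> (\<forall>x. contract x \<omega> = 0)"
| "is_form (Suc k) \<omega> \<longleftrightarrow>
     \<omega> [] = 0 \<and>
     (\<forall>x. x \<notin> D \<longrightarrow> contract x \<omega> = 0) \<and>
     (\<forall>x\<in>D. is_form k (contract x \<omega>)) \<and>
     (\<forall>x\<in>D. \<forall>y\<in>D. contract (x + y) \<omega> = contract x \<omega> + contract y \<omega>) \<and>
     (\<forall>x\<in>D. \<forall>a. contract (Der_scale act a x) \<omega> = form_scale a (contract x \<omega>)) \<and>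
     (\<forall>x\<in>D. contract x (contract x \<omega>) = 0)"

lemma is_form_zero [simp]: "is_form k 0"
proof (induction k)
  show "is_form 0 0" by simp
  show "is_form (Suc k) 0" if "is_form k 0" for k
    using that by simp
qed

lemma is_form_outside: "\<lbrakk>is_form k \<omega>; x \<notin> D\<rbrakk> \<Longrightarrow> contract x \<omega> = 0"
  by (cases k) auto

lemma is_form_contract: "\<lbrakk>is_form k \<omega>; x \<in> D\<rbrakk> \<Longrightarrow> is_form (k - 1) (contract x \<omega>)"
  by (cases k) auto

lemma contract_add_left:
  "\<lbrakk>is_form k \<omega>; x \<in> D; y \<in> D\<rbrakk> \<Longrightarrow> contract (x + y) \<omega> = contract x \<omega> + contract y \<omega>"
  by (cases k) auto

lemma contract_scale:
  "\<lbrakk>is_form k \<omega>; x \<in> D\<rbrakk> \<Longrightarrow> contract (Der_scale act a x) \<omega> = form_scale a (contract x \<omega>)"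
  by (cases k) auto

lemma contract_contract_same:
  "\<lbrakk>is_form k \<omega>; x \<in> D\<rbrakk> \<Longrightarrow> contract x (contract x \<omega>) = 0"
  by (cases k) auto

lemma contract_diff_left:
  assumes "is_form k \<omega>" "x \<in> D" "y \<in> D"
  shows "contract (x - y) \<omega> = contract x \<omega> - contract y \<omega>"
  unfolding diff_eq_add_scale[of x y] contract_add_left[OF assms(1,2) D_scale[OF assms(3)]]
    contract_scale[OF assms(1,3)]
  by (simp add: fun_eq_iff)

lemma contract_zero_left:
  assumes "is_form k \<omega>" "0 \<in> D" shows "contract 0 \<omega> = 0"
  using contract_diff_left[OF assms assms(2)] by simp

lemma is_form_add: "\<lbrakk>is_form k \<omega>; is_form k \<eta>\<rbrakk> \<Longrightarrow> is_form k (\<omega> + \<eta>)"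
  by (induction k arbitrary: \<omega> \<eta>) (auto simp: form_scale_add algebra_simps)

lemma is_form_scale: "is_form k \<omega> \<Longrightarrow> is_form k (form_scale a \<omega>)"
  by (induction k arbitrary: \<omega>) (auto simp: form_scale_add form_scale_commute[of a])

lemma is_form_diff: "\<lbrakk>is_form k \<omega>; is_form k \<eta>\<rbrakk> \<Longrightarrow> is_form k (\<omega> - \<eta>)"
  unfolding form_diff_eq_add_scale by (intro is_form_add is_form_scale)

text \<open>
  Polarization of the alternating condition. The hypotheses are spelled out instead of being
  collected in \<^const>\<open>is_form\<close> because the lemma is needed for the exterior differential before the
  latter is known to be a form.
\<close>

lemma contract_swap_of_alternating:
  assumes form: "\<And>x. x \<in> D \<Longrightarrow> is_form k (contract x \<omega>)"
    and add: "\<And>x y. \<lbrakk>x \<in> D; y \<in> D\<rbrakk> \<Longrightarrow> contract (x + y) \<omega> = contract x \<omega> + contract y \<omega>"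
    and alt: "\<And>x. x \<in> D \<Longrightarrow> contract x (contract x \<omega>) = 0"
    and x: "x \<in> D" and y: "y \<in> D"
  shows "contract x (contract y \<omega>) = - contract y (contract x \<omega>)"
proof -
  have "0 = contract (x + y) (contract (x + y) \<omega>)"
    using alt D_add x y by simp
  also have "\<dots> = contract y (contract x \<omega>) + contract x (contract y \<omega>)"
    using x y
    by (simp add: add alt contract_add_left[OF form[OF x] x y] contract_add_left[OF form[OF y] x y])
  finally show ?thesis
    by (metis add.commute eq_neg_iff_add_eq_0)
qed

lemma contract_swap:
  assumes "is_form k \<omega>" "x \<in> D" "y \<in> D"
  shows "contract x (contract y \<omega>) = - contract y (contract x \<omega>)"
  using contract_swap_of_alternating[OF is_form_contract[OF assms(1)]
      contract_add_left[OF assms(1)] contract_contract_same[OF assms(1)] assms(2,3)] .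

section \<open>Lie derivative and exterior differential\<close>

text \<open>
  The recursion is the commutation rule \<open>\<iota>\<^sub>z L\<^sub>X = L\<^sub>X \<iota>\<^sub>z - \<iota>\<^bsub>[X,z]\<^esub>\<close>. The guard keeps the Lie derivative
  zero on lists with an entry outside \<open>D\<close>, where a commutator might lie in \<open>D\<close> again.
\<close>

fun lie :: "('p \<Rightarrow> 'p) \<Rightarrow> (('p \<Rightarrow> 'p) list \<Rightarrow> 'p) \<Rightarrow> ('p \<Rightarrow> 'p) list \<Rightarrow> 'p" where
  "lie X \<omega> [] = X (\<omega> [])"
| "lie X \<omega> (z # zs) =
     (if z \<in> D then lie X (contract z \<omega>) zs - \<omega> (commutator X z # zs) else 0)"

text \<open>
  The recursion is Cartan's magic formula \<open>\<iota>\<^sub>x d = L\<^sub>x - d \<iota>\<^sub>x\<close>, taken as a definition.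
\<close>

fun ext_d :: "(('p \<Rightarrow> 'p) list \<Rightarrow> 'p) \<Rightarrow> ('p \<Rightarrow> 'p) list \<Rightarrow> 'p" where
  "ext_d \<omega> [] = 0"
| "ext_d \<omega> (x # xs) = (if x \<in> D then lie x \<omega> xs - ext_d (contract x \<omega>) xs else 0)"

lemma contract_lie:
  "z \<in> D \<Longrightarrow> contract z (lie X \<omega>) = lie X (contract z \<omega>) - contract (commutator X z) \<omega>"
  by (simp add: fun_eq_iff)

lemma contract_ext_d: "x \<in> D \<Longrightarrow> contract x (ext_d \<omega>) = lie x \<omega> - ext_d (contract x \<omega>)"
  by (simp add: fun_eq_iff)

lemma lie_add: "X \<in> D \<Longrightarrow> lie X (\<omega> + \<eta>) = lie X \<omega> + lie X \<eta>"
proof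
  show "X \<in> D \<Longrightarrow> lie X (\<omega> + \<eta>) xs = (lie X \<omega> + lie X \<eta>) xs" for xs
    by (induction xs arbitrary: \<omega> \<eta>) (simp_all add: D_additive)
qed

lemma lie_diff: "X \<in> D \<Longrightarrow> lie X (\<omega> - \<eta>) = lie X \<omega> - lie X \<eta>"
  using lie_add[of X "\<omega> - \<eta>" \<eta>] by (simp add: algebra_simps)

lemma lie_zero [simp]: "X \<in> D \<Longrightarrow> lie X 0 = 0"
  using lie_diff[of X 0 0] by simp

text \<open>
  The Lie derivative is a derivation over the symbol of its operator: scaling by \<open>a\<close> commutes with
  all terms except the one in which the operator acts on the value of the form.
\<close>

lemma lie_scale:
  assumes "X \<in> D" "is_form k \<omega>" and \<sigma>: "\<And>a p. X (act a p) = act (\<sigma> a) p + act a (X p)"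
  shows "lie X (form_scale a \<omega>) xs = act (\<sigma> a) (\<omega> xs) + act a (lie X \<omega> xs)"
  using assms(2)
proof (induction xs arbitrary: \<omega> k)
  case (Cons z zs)
  have IH: "lie X (form_scale a \<omega>) zs = act (\<sigma> a) (\<omega> zs) + act a (lie X \<omega> zs)"
    if "is_form k \<omega>" for k \<omega>
    using that by (rule Cons.IH)
  show "lie X (form_scale a \<omega>) (z # zs) = act (\<sigma> a) (\<omega> (z # zs)) + act a (lie X \<omega> (z # zs))"
  proof (cases "z \<in> D")
    case True
    then show ?thesis
      using IH[OF is_form_contract[OF Cons.prems True]]
      by (simp add: scale_right_diff_distrib)
  next
    case False
    then have "contract z \<omega> zs = 0"
      using is_form_outside[OF Cons.prems] by simp
    then show ?thesis using False by simp
  qed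
qed (simp add: \<sigma>)

text \<open>
  In the multilinearity over \<open>A\<close> two defects cancel: \<open>X\<close> applied to a multiple of a value and
  the commutator of \<open>X\<close> with a multiple of an argument both contribute \<open>\<sigma> a\<close> times the form.
\<close>

lemma is_form_lie: "\<lbrakk>X \<in> D; is_form k \<omega>\<rbrakk> \<Longrightarrow> is_form k (lie X \<omega>)"
proof (induction k arbitrary: \<omega>)
  case 0
  then have "contract z (lie X \<omega>) = 0" for z
    by (cases "z \<in> D") (simp_all add: contract_lie fun_eq_iff[of "contract z (lie X \<omega>)"])
  then show ?case by simp
next
  case (Suc k)
  note X = Suc.prems(1) and \<omega> = Suc.prems(2)
  have form: "is_form k (contract z (lie X \<omega>))" if z: "z \<in> D" for z
    unfolding contract_lie[OF z]
    using Suc.IH[OF X] is_form_contract[OF \<omega>] z D_commutator[OF X z] by (intro is_form_diff) auto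
  have add: "contract (y + z) (lie X \<omega>) = contract y (lie X \<omega>) + contract z (lie X \<omega>)"
    if "y \<in> D" "z \<in> D" for y z
    using that X
    by (simp add: contract_lie D_add contract_add_left[OF \<omega>] lie_add commutator_add_right
        D_commutator)
  have scale: "contract (Der_scale act a z) (lie X \<omega>) = form_scale a (contract z (lie X \<omega>))"
    if z: "z \<in> D" for a z
  proof -
    obtain \<sigma> where \<sigma>: "\<And>a p. X (act a p) = act (\<sigma> a) p + act a (X p)"
      using D_symbol[OF X] by blast
    have comm: "commutator X (Der_scale act a z)
        = Der_scale act (\<sigma> a) z + Der_scale act a (commutator X z)"
      by (simp add: fun_eq_iff commutator_def Der_scale_def \<sigma> scale_right_diff_distrib)
    have "contract (commutator X (Der_scale act a z)) \<omega>
        = (\<lambda>xs. act (\<sigma> a) (\<omega> (z # xs)) + act a (\<omega> (commutator X z # xs)))"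
      unfolding comm contract_add_left[OF \<omega> D_scale[OF z] D_scale[OF D_commutator[OF X z]]]
        contract_scale[OF \<omega> z] contract_scale[OF \<omega> D_commutator[OF X z]]
      by (simp add: fun_eq_iff)
    moreover have "lie X (contract (Der_scale act a z) \<omega>)
        = (\<lambda>xs. act (\<sigma> a) (\<omega> (z # xs)) + act a (lie X (contract z \<omega>) xs))"
      using lie_scale[OF X is_form_contract[OF \<omega> z] \<sigma>, of a]
      by (simp add: contract_scale[OF \<omega> z] fun_eq_iff)
    ultimately show ?thesis
      unfolding contract_lie[OF D_scale[OF z]] using z
      by (simp add: fun_eq_iff scale_right_diff_distrib)
  qed
  have alt: "contract z (contract z (lie X \<omega>)) = 0" if z: "z \<in> D" for z
    using z X
    by (simp add: contract_lie contract_contract_same[OF \<omega>]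
        contract_swap[OF \<omega> z D_commutator[OF X z]])
  have "contract z (lie X \<omega>) = 0" if "z \<notin> D" for z
    using that by (simp add: fun_eq_iff)
  then show ?case
    using form add scale alt \<omega> X by (simp add: D_zero)
qed

lemma lie_add_left:
  assumes "X \<in> D" "Y \<in> D" "is_form k \<omega>"
  shows "lie (X + Y) \<omega> xs = lie X \<omega> xs + lie Y \<omega> xs"
  using assms(3)
proof (induction xs arbitrary: \<omega> k)
  case (Cons z zs)
  have IH: "lie (X + Y) \<omega> zs = lie X \<omega> zs + lie Y \<omega> zs" if "is_form k \<omega>" for k \<omega>
    using that by (rule Cons.IH)
  show "lie (X + Y) \<omega> (z # zs) = lie X \<omega> (z # zs) + lie Y \<omega> (z # zs)"
  proof (cases "z \<in> D")
    case True
    have "contract (commutator (X + Y) z) \<omega> zs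
        = contract (commutator X z) \<omega> zs + contract (commutator Y z) \<omega> zs"
      using assms True
      by (simp only: commutator_add_left contract_add_left[OF Cons.prems] D_commutator
          plus_fun_apply)
    then show ?thesis
      using True IH[OF is_form_contract[OF Cons.prems True]] by simp
  qed simp
qed simp

text \<open>
  The Lie derivative represents the Lie algebra of operators on forms. On values this is the
  definition of the commutator, on arguments it is the Jacobi identity.
\<close>

lemma lie_lie:
  assumes X: "X \<in> D" and Y: "Y \<in> D" and "is_form k \<omega>"
  shows "lie X (lie Y \<omega>) xs - lie Y (lie X \<omega>) xs = lie (commutator X Y) \<omega> xs"
  using assms(3)
proof (induction xs arbitrary: \<omega> k)
  case Nil
  then show ?case by (simp add: commutator_def)
next
  case (Cons z zs)
  show ?case
  proof (cases "z \<in> D")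
    case z: True
    have expand: "lie U (lie V \<omega>) (z # zs) = lie U (lie V (contract z \<omega>)) zs
        - lie U (contract (commutator V z) \<omega>) zs - lie V (contract (commutator U z) \<omega>) zs
        + contract (commutator V (commutator U z)) \<omega> zs"
      if "U \<in> D" "V \<in> D" for U V
      using that z by (simp add: contract_lie lie_diff D_commutator)
    have IH: "lie X (lie Y (contract z \<omega>)) zs - lie Y (lie X (contract z \<omega>)) zs
        = lie (commutator X Y) (contract z \<omega>) zs"
      by (rule Cons.IH[OF is_form_contract[OF Cons.prems z]])
    have jacobi: "contract (commutator X (commutator Y z)) \<omega> zs
        - contract (commutator Y (commutator X z)) \<omega> zs
        = contract (commutator (commutator X Y) z) \<omega> zs"
      using X Y z
      by (simp only: commutator_jacobi contract_diff_left[OF Cons.prems] D_commutator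
          minus_apply)
    have "lie X (lie Y \<omega>) (z # zs) - lie Y (lie X \<omega>) (z # zs)
        = (lie X (lie Y (contract z \<omega>)) zs - lie Y (lie X (contract z \<omega>)) zs)
          - (contract (commutator X (commutator Y z)) \<omega> zs
             - contract (commutator Y (commutator X z)) \<omega> zs)"
      unfolding expand[OF X Y] expand[OF Y X] by (simp add: algebra_simps)
    also have "\<dots> = lie (commutator X Y) \<omega> (z # zs)"
      unfolding IH jacobi using z by simp
    finally show ?thesis .
  qed simp
qed

lemma ext_d_add: "ext_d (\<omega> + \<eta>) = ext_d \<omega> + ext_d \<eta>"
proof
  show "ext_d (\<omega> + \<eta>) xs = (ext_d \<omega> + ext_d \<eta>) xs" for xs
    by (induction xs arbitrary: \<omega> \<eta>) (simp_all add: lie_add)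
qed

lemma ext_d_diff: "ext_d (\<omega> - \<eta>) = ext_d \<omega> - ext_d \<eta>"
  using ext_d_add[of "\<omega> - \<eta>" \<eta>] by (simp add: algebra_simps)

lemma ext_d_zero [simp]: "ext_d 0 = 0"
  using ext_d_diff[of 0 0] by simp

text \<open>
  By the magic formula the contractions of \<open>d\<omega>\<close> are forms. Additivity in the first argument is
  inherited from the Lie derivative, and the alternating property is the cancellation
  \<open>\<iota>\<^sub>x \<iota>\<^sub>x d = \<iota>\<^sub>x L\<^sub>x - \<iota>\<^sub>x d \<iota>\<^sub>x = \<iota>\<^sub>x L\<^sub>x - L\<^sub>x \<iota>\<^sub>x = 0\<close>. Homogeneity over \<open>A\<close> in the first argument is
  harder, since the Lie derivative is not homogeneous in its operator; it follows by swapping the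
  first two arguments, because homogeneity in the second one is already available.
\<close>

lemma is_form_ext_d: "is_form k \<omega> \<Longrightarrow> is_form (Suc k) (ext_d \<omega>)"
proof (induction k arbitrary: \<omega> rule: nat_less_induct)
  case (1 k \<omega>)
  note \<omega> = 1(2)
  have sub: "is_form k (ext_d (contract x \<omega>))" if "x \<in> D" for x
  proof (cases k)
    case 0
    then show ?thesis using \<omega> by simp
  next
    case (Suc m)
    then have "is_form m (contract x \<omega>)"
      using is_form_contract[OF \<omega> that] by (simp only: diff_Suc_1)
    then have "is_form (Suc m) (ext_d (contract x \<omega>))"
      by (rule 1(1)[rule_format, rotated]) (simp add: Suc)
    then show ?thesis unfolding Suc .
  qed
  have form: "is_form k (contract x (ext_d \<omega>))" if "x \<in> D" for x
    unfolding contract_ext_d[OF that] by (intro is_form_diff is_form_lie that \<omega> sub)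
  have add: "contract (x + y) (ext_d \<omega>) = contract x (ext_d \<omega>) + contract y (ext_d \<omega>)"
    if "x \<in> D" "y \<in> D" for x y
  proof -
    have "lie (x + y) \<omega> = lie x \<omega> + lie y \<omega>"
      using lie_add_left[OF that \<omega>] by (simp add: fun_eq_iff)
    then show ?thesis
      using that by (simp add: contract_ext_d D_add contract_add_left[OF \<omega>] ext_d_add)
  qed
  have alt: "contract x (contract x (ext_d \<omega>)) = 0" if x: "x \<in> D" for x
  proof -
    have "commutator x x = 0"
      by (simp add: fun_eq_iff commutator_def)
    then have "contract (commutator x x) \<omega> = 0"
      using contract_zero_left[OF \<omega>] D_commutator[OF x x] by simp
    then show ?thesis
      using x by (simp add: contract_ext_d contract_lie contract_contract_same[OF \<omega>])
  qed
  have scale: "contract (Der_scale act a x) (ext_d \<omega>) = form_scale a (contract x (ext_d \<omega>))"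
    if x: "x \<in> D" for a x
  proof
    note ax = D_scale[OF x, of a]
    show "contract (Der_scale act a x) (ext_d \<omega>) xs = form_scale a (contract x (ext_d \<omega>)) xs" for xs
    proof (cases xs)
      case Nil
      then show ?thesis using x ax by (simp add: Der_scale_def)
    next
      case (Cons y ys)
      show ?thesis
      proof (cases "y \<in> D")
        case False
        then show ?thesis using Cons x ax by simp
      next
        case y: True
        have swap: "contract y (contract z (ext_d \<omega>)) = - contract z (contract y (ext_d \<omega>))"
          if "z \<in> D" for z
          by (rule contract_swap_of_alternating[OF form add alt y that])
        have "contract y (contract (Der_scale act a x) (ext_d \<omega>)) ys
            = act a (contract y (contract x (ext_d \<omega>)) ys)"
          unfolding swap[OF ax] swap[OF x] contract_scale[OF form[OF y] x] by simp
        then show ?thesis using Cons by simp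
      qed
    qed
  qed
  have "contract x (ext_d \<omega>) = 0" if "x \<notin> D" for x
    using that by (simp add: fun_eq_iff)
  then show ?case
    using form add alt scale by simp
qed

text \<open>
  Contracting \<open>L\<^sub>X d - d L\<^sub>X\<close> with \<open>y\<close> gives \<open>L\<^sub>X L\<^sub>y - L\<^sub>y L\<^sub>X - L\<^bsub>[X,y]\<^esub>\<close>, which vanishes because
  \<open>L\<close> represents the commutator (\<open>lie_lie\<close>), minus the same commutator applied to the contracted form.
\<close>

lemma lie_ext_d:
  assumes X: "X \<in> D" and "is_form k \<omega>"
  shows "lie X (ext_d \<omega>) xs = ext_d (lie X \<omega>) xs"
  using assms(2)
proof (induction xs arbitrary: \<omega> k)
  case Nil
  then show ?case using X by (simp add: D_zero)
next
  case (Cons y ys)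
  show ?case
  proof (cases "y \<in> D")
    case y: True
    have IH: "lie X (ext_d (contract y \<omega>)) ys = ext_d (lie X (contract y \<omega>)) ys"
      by (rule Cons.IH[OF is_form_contract[OF Cons.prems y]])
    have "lie X (ext_d \<omega>) (y # ys) = lie X (lie y \<omega>) ys - lie X (ext_d (contract y \<omega>)) ys
        - (lie (commutator X y) \<omega> ys - ext_d (contract (commutator X y) \<omega>) ys)"
      using X y by (simp add: contract_ext_d lie_diff D_commutator)
    also have "\<dots> = lie y (lie X \<omega>) ys
        - (ext_d (lie X (contract y \<omega>)) ys - ext_d (contract (commutator X y) \<omega>) ys)"
      unfolding IH lie_lie[OF X y Cons.prems, symmetric] by simp
    also have "\<dots> = ext_d (lie X \<omega>) (y # ys)"
      using y by (simp add: contract_lie ext_d_diff)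
    finally show ?thesis .
  qed simp
qed

text \<open>
  Two applications of the magic formula give \<open>\<iota>\<^sub>x d d = (L\<^sub>x d - d L\<^sub>x) + d d \<iota>\<^sub>x\<close>.
\<close>

lemma ext_d_ext_d:
  assumes "is_form k \<omega>" shows "ext_d (ext_d \<omega>) xs = 0"
  using assms
proof (induction xs arbitrary: \<omega> k)
  case (Cons x xs)
  show ?case
  proof (cases "x \<in> D")
    case x: True
    have "ext_d (ext_d (contract x \<omega>)) xs = 0"
      by (rule Cons.IH[OF is_form_contract[OF Cons.prems x]])
    then show ?thesis
      using x lie_ext_d[OF x Cons.prems, of xs]
      by (simp add: contract_ext_d ext_d_diff)
  qed simp
qed simp


section \<open>Comparison with list-indexed alternating maps and the Cartan formula\<close>

lemma is_form_off_tuples: "\<lbrakk>is_form k \<omega>; xs \<notin> tuples D k\<rbrakk> \<Longrightarrow> \<omega> xs = 0"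
proof (induction k arbitrary: \<omega> xs)
  case 0
  then obtain x ys where "xs = x # ys"
    by (cases xs) (auto simp: tuples_def)
  moreover have "contract x \<omega> = 0" using 0(1) by simp
  from fun_cong[OF this, of ys] have "\<omega> (x # ys) = 0" by simp
  ultimately show ?case by simp
next
  case (Suc k)
  show ?case
  proof (cases xs)
    case Nil
    then show ?thesis using Suc.prems(1) by simp
  next
    case (Cons x ys)
    have "contract x \<omega> ys = 0"
    proof (cases "x \<in> D")
      case True
      show ?thesis
      proof (rule Suc.IH)
        show "is_form k (contract x \<omega>)" using is_form_contract[OF Suc.prems(1) True] by simp
        show "ys \<notin> tuples D k" using Suc.prems(2) Cons True by (simp add: tuples_Cons)
      qed
    next
      case False
      then show ?thesis using is_form_outside[OF Suc.prems(1)] by simp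
    qed
    then show ?thesis using Cons by simp
  qed
qed

lemma is_form_update_add:
  "\<lbrakk>is_form k \<omega>; xs \<in> tuples D k; i < k; x \<in> D; y \<in> D\<rbrakk>
    \<Longrightarrow> \<omega> (xs[i := x + y]) = \<omega> (xs[i := x]) + \<omega> (xs[i := y])"
proof (induction k arbitrary: \<omega> xs i)
  case (Suc k)
  obtain z zs where xs: "xs = z # zs"
    using Suc.prems(2) by (cases xs) (auto simp: tuples_def)
  then have z: "z \<in> D" "zs \<in> tuples D k"
    using Suc.prems(2) by (auto simp: tuples_Cons)
  show "\<omega> (xs[i := x + y]) = \<omega> (xs[i := x]) + \<omega> (xs[i := y])"
  proof (cases i)
    case 0
    then show ?thesis
      using fun_cong[OF contract_add_left[OF Suc.prems(1,4,5)], of zs] xs by simp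
  next
    case (Suc i')
    have "is_form k (contract z \<omega>)"
      using is_form_contract[OF Suc.prems(1) z(1)] by simp
    then have "contract z \<omega> (zs[i' := x + y]) = contract z \<omega> (zs[i' := x]) + contract z \<omega> (zs[i' := y])"
      using z(2) by (rule Suc.IH) (use Suc Suc.prems(3-5) in simp_all)
    then show ?thesis using Suc xs by simp
  qed
qed simp

lemma is_form_update_scale:
  "\<lbrakk>is_form k \<omega>; xs \<in> tuples D k; i < k; x \<in> D\<rbrakk>
    \<Longrightarrow> \<omega> (xs[i := Der_scale act a x]) = act a (\<omega> (xs[i := x]))"
proof (induction k arbitrary: \<omega> xs i)
  case (Suc k)
  obtain z zs where xs: "xs = z # zs"
    using Suc.prems(2) by (cases xs) (auto simp: tuples_def)
  then have z: "z \<in> D" "zs \<in> tuples D k"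
    using Suc.prems(2) by (auto simp: tuples_Cons)
  show ?case
  proof (cases i)
    case 0
    then show ?thesis
      using fun_cong[OF contract_scale[OF Suc.prems(1,4)], of a zs] xs by simp
  next
    case (Suc i')
    have "is_form k (contract z \<omega>)"
      using is_form_contract[OF Suc.prems(1) z(1)] by simp
    then have "contract z \<omega> (zs[i' := Der_scale act a x]) = act a (contract z \<omega> (zs[i' := x]))"
      using z(2) by (rule Suc.IH) (use Suc Suc.prems(3,4) in simp_all)
    then show ?thesis using Suc xs by simp
  qed
qed simp

text \<open>
  If the repeated entry sits at the head and further right, but not next to the head, exchanging the
  first two arguments moves the head entry into the tail, where the induction hypothesis applies.
\<close>

lemma is_form_repeat:
  "\<lbrakk>is_form k \<omega>; xs \<in> tuples D k; i < j; j < k; xs ! i = xs ! j\<rbrakk> \<Longrightarrow> \<omega> xs = 0"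
proof (induction k arbitrary: \<omega> xs i j)
  case (Suc k)
  obtain x zs where xs: "xs = x # zs"
    using Suc.prems(2) by (cases xs) (auto simp: tuples_def)
  then have x: "x \<in> D" "zs \<in> tuples D k"
    using Suc.prems(2) by (auto simp: tuples_Cons)
  obtain j' where j: "j = Suc j'"
    using Suc.prems(3) by (cases j) auto
  show ?case
  proof (cases i)
    case (Suc i')
    have "is_form k (contract x \<omega>)"
      using is_form_contract[OF Suc.prems(1) x(1)] by simp
    then have "contract x \<omega> zs = 0"
      using x(2) by (rule Suc.IH[of _ _ i' j']) (use Suc Suc.prems(3-5) xs j in simp_all)
    then show ?thesis using xs by simp
  next
    case 0
    obtain k' where k: "k = Suc k'"
      using Suc.prems(4) j by (cases k) auto
    then obtain y ys where zs: "zs = y # ys" and y: "y \<in> D" "ys \<in> tuples D k'"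
      using x(2) by (cases zs) (auto simp: tuples_def)
    show ?thesis
    proof (cases j')
      case 0
      then show ?thesis
        using Suc.prems(5) \<open>i = 0\<close> xs zs j fun_cong[OF contract_contract_same[OF Suc.prems(1) x(1)], of ys]
        by simp
    next
      case (Suc j'')
      have "contract y \<omega> (x # ys) = 0"
      proof (rule Suc.IH[of "contract y \<omega>" "x # ys" 0 "Suc j''"])
        show "is_form k (contract y \<omega>)"
          using is_form_contract[OF Suc.prems(1) y(1)] by simp
      qed (use Suc Suc.prems \<open>i = 0\<close> xs zs j x y k in \<open>auto simp: tuples_Cons\<close>)
      then show ?thesis
        using fun_cong[OF contract_swap[OF Suc.prems(1) x(1) y(1)], of ys] xs zs by simp
    qed
  qed
qed simp

lemma is_form_of_alt_forms:
  "\<omega> \<in> alt_forms D (Der_scale act) UNIV act k \<Longrightarrow> is_form k \<omega>"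
proof (induction k arbitrary: \<omega>)
  case 0
  then have "\<omega> (x # xs) = 0" for x xs
    by (auto simp: alt_forms_def tuples_def)
  then show ?case by (simp add: fun_eq_iff)
next
  case (Suc k)
  note off = alt_formsD(2)[OF Suc.prems] and add = alt_formsD(3)[OF Suc.prems]
    and scale = alt_formsD(4)[OF Suc.prems] and rep = alt_formsD(5)[OF Suc.prems]
  have 1: "\<omega> [] = 0"
    by (rule off) (simp add: tuples_def)
  have 2: "contract x \<omega> = 0" if "x \<notin> D" for x
    using off that by (simp add: fun_eq_iff tuples_Cons)
  have 3: "is_form k (contract x \<omega>)" if x: "x \<in> D" for x
  proof (rule Suc.IH, rule alt_formsI)
    show "contract x \<omega> xs = 0" if "xs \<notin> tuples D k" for xs
      using off[of "x # xs"] that by (simp add: tuples_Cons)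
    show "contract x \<omega> (xs[i := y + z]) = contract x \<omega> (xs[i := y]) + contract x \<omega> (xs[i := z])"
      if "xs \<in> tuples D k" "i < k" "y \<in> D" "z \<in> D" for xs i y z
      using add[of "x # xs" "Suc i" y z] that x by (simp add: tuples_Cons)
    show "contract x \<omega> (xs[i := Der_scale act a y]) = act a (contract x \<omega> (xs[i := y]))"
      if "xs \<in> tuples D k" "i < k" "y \<in> D" for xs i y a
      using scale[of "x # xs" "Suc i" y a] that x by (simp add: tuples_Cons)
    show "contract x \<omega> xs = 0"
      if "xs \<in> tuples D k" "i < j" "j < k" "xs ! i = xs ! j" for xs i j
      using rep[of "x # xs" "Suc i" "Suc j"] that x by (simp add: tuples_Cons)
  qed simp
  have 4: "contract (x + y) \<omega> = contract x \<omega> + contract y \<omega>" if "x \<in> D" "y \<in> D" for x y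
  proof
    show "contract (x + y) \<omega> xs = (contract x \<omega> + contract y \<omega>) xs" for xs
      using add[of "x # xs" 0 x y] that off[of "_ # xs"]
      by (cases "xs \<in> tuples D k") (auto simp: tuples_Cons)
  qed
  have 5: "contract (Der_scale act a x) \<omega> = form_scale a (contract x \<omega>)" if "x \<in> D" for x a
  proof
    show "contract (Der_scale act a x) \<omega> xs = form_scale a (contract x \<omega>) xs" for xs
      using scale[of "x # xs" 0 x a] that off[of "_ # xs"]
      by (cases "xs \<in> tuples D k") (auto simp: tuples_Cons)
  qed
  have 6: "contract x (contract x \<omega>) = 0" if "x \<in> D" for x
  proof
    show "contract x (contract x \<omega>) xs = 0 xs" for xs
      using rep[of "x # x # xs" 0 1] off[of "x # x # xs"]
      by (cases "x # x # xs \<in> tuples D (Suc k)") (auto simp: tuples_def)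
  qed
  show ?case using 1 2 3 4 5 6 by simp
qed

lemma alt_forms_iff_is_form:
  "\<omega> \<in> alt_forms D (Der_scale act) UNIV act k \<longleftrightarrow> is_form k \<omega>"
proof
  show "\<omega> \<in> alt_forms D (Der_scale act) UNIV act k" if "is_form k \<omega>"
    by (rule alt_formsI[OF UNIV_I is_form_off_tuples[OF that] is_form_update_add[OF that]
          is_form_update_scale[OF that] is_form_repeat[OF that]])
qed (rule is_form_of_alt_forms)

text \<open>
  The commutator replaces an argument in place in the Lie derivative but stands in front in the
  Cartan formula; moving it there past \<open>j\<close> arguments produces the sign.
\<close>

lemma lie_eq_sum:
  assumes "x \<in> D" "is_form k \<omega>" "set xs \<subseteq> D"
  shows "lie x \<omega> xs = x (\<omega> xs) -
    (\<Sum>j<length xs. signed j (\<omega> (commutator x (xs ! j) # nths xs (- {j}))))"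
  using assms(2,3)
proof (induction xs arbitrary: \<omega> k)
  case (Cons z zs)
  have z: "z \<in> D" using Cons.prems by simp
  have IH: "lie x (contract z \<omega>) zs = x (contract z \<omega> zs) -
      (\<Sum>j<length zs. signed j (contract z \<omega> (commutator x (zs ! j) # nths zs (- {j}))))"
    by (rule Cons.IH[OF is_form_contract[OF Cons.prems(1) z]]) (use Cons.prems in simp)
  have swap: "\<omega> (z # commutator x (zs ! j) # ys) = - \<omega> (commutator x (zs ! j) # z # ys)"
    if "j < length zs" for j ys
  proof -
    have "zs ! j \<in> D" using Cons.prems(2) that by auto
    from fun_cong[OF contract_swap[OF Cons.prems(1) z D_commutator[OF assms(1) this]], of ys]
    show ?thesis by simp
  qed
  show ?case
    using z swap
    by (simp add: IH sum.lessThan_Suc_shift nths_Compl_Suc nths_Compl_0 signed_Suc signed_minus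
        sum_negf del: sum.lessThan_Suc)
qed simp

text \<open>
  The Cartan formula with the length of the list in the role of \<open>Suc k\<close>. It makes sense for the
  empty list too, which lets an induction on the list start without a separate case.
\<close>

definition cartan_sum :: "(('p \<Rightarrow> 'p) list \<Rightarrow> 'p) \<Rightarrow> ('p \<Rightarrow> 'p) list \<Rightarrow> 'p" where
  "cartan_sum \<omega> xs =
     (\<Sum>i<length xs. signed i ((xs ! i) (\<omega> (nths xs (- {i}))))) +
     (\<Sum>j<length xs. \<Sum>i<j.
        signed (i + j) (\<omega> (commutator (xs ! i) (xs ! j) # nths xs (- {i, j}))))"

text \<open>
  Splitting off the terms in which the first argument \<open>x\<close> acts or is commuted leaves the Lie
  derivative along \<open>x\<close>. In all other terms \<open>x\<close> is an argument of the form; removing it shifts the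
  positions by one and changes the sign, so that these terms add up to minus the Cartan formula of
  the contraction. In the commutator terms the index shift leaves \<open>i + j\<close> even or odd as before and
  the sign comes from moving \<open>x\<close> to the front.
\<close>

lemma cartan_sum_eq_ext_d:
  assumes "is_form k \<omega>" "set xs \<subseteq> D"
  shows "cartan_sum \<omega> xs = ext_d \<omega> xs"
  using assms
proof (induction xs arbitrary: \<omega> k)
  case (Cons x xs)
  have x: "x \<in> D" using Cons.prems by simp
  have xs: "xs ! j \<in> D" if "j < length xs" for j using Cons.prems(2) that by auto
  have IH: "cartan_sum (contract x \<omega>) xs = ext_d (contract x \<omega>) xs"
    by (rule Cons.IH[OF is_form_contract[OF Cons.prems(1) x]]) (use Cons.prems in simp)
  have swap: "\<omega> (commutator (xs ! i) (xs ! j) # x # ys) = - \<omega> (x # commutator (xs ! i) (xs ! j) # ys)"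
    if "i < j" "j < length xs" for i j ys
    using fun_cong[OF contract_swap[OF Cons.prems(1) D_commutator[OF xs xs] x, of i j], of ys]
      that by simp
  have "cartan_sum \<omega> (x # xs) = lie x \<omega> xs - cartan_sum (contract x \<omega>) xs"
    using swap lie_eq_sum[OF x Cons.prems(1), of xs] Cons.prems(2)
    by (simp add: cartan_sum_def sum.lessThan_Suc_shift nths_Compl_Suc nths_Compl_0
       nths_Compl_0_Suc nths_Compl_Suc_Suc signed_Suc signed_minus sum_negf sum.distrib sum_subtractf
       del: sum.lessThan_Suc)
  then show ?case using IH x by simp
qed (simp add: cartan_sum_def)

lemma cartan_d_eq_ext_d:
  assumes "is_form k \<omega>"
  shows "cartan_d D k \<omega> = ext_d \<omega>"
proof
  show "cartan_d D k \<omega> xs = ext_d \<omega> xs" for xs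
  proof (cases "xs \<in> tuples D (Suc k)")
    case True
    then have "length xs = Suc k" "set xs \<subseteq> D" by (auto simp: tuples_def)
    then show ?thesis
      using cartan_sum_eq_ext_d[OF assms, of xs] True by (simp only: cartan_d_def cartan_sum_def if_True)
  next
    case False
    then show ?thesis
      using is_form_off_tuples[OF is_form_ext_d[OF assms] False] by (simp add: cartan_d_def)
  qed
qed

theorem cartan_d_in_alt_forms:
  assumes "\<omega> \<in> alt_forms D (Der_scale act) UNIV act k"
  shows "cartan_d D k \<omega> \<in> alt_forms D (Der_scale act) UNIV act (Suc k)"
  using assms unfolding alt_forms_iff_is_form by (simp only: cartan_d_eq_ext_d is_form_ext_d)

theorem cartan_d_cartan_d:
  assumes "\<omega> \<in> alt_forms D (Der_scale act) UNIV act k"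
  shows "cartan_d D (Suc k) (cartan_d D k \<omega>) = 0"
proof -
  have \<omega>: "is_form k \<omega>" using assms by (simp only: alt_forms_iff_is_form)
  show ?thesis
    unfolding cartan_d_eq_ext_d[OF \<omega>] cartan_d_eq_ext_d[OF is_form_ext_d[OF \<omega>]]
    using ext_d_ext_d[OF \<omega>] by (simp add: fun_eq_iff)
qed

end

section \<open>Tuples with omitted entries and forms of degree 0\<close>

lemma tuples_update: "\<lbrakk>xs \<in> tuples D k; x \<in> D\<rbrakk> \<Longrightarrow> xs[i := x] \<in> tuples D k"
  using set_update_subset_insert[of xs i x] by (auto simp: tuples_def)

lemma nths_Compl_in_tuples:
  assumes "xs \<in> tuples D k" "I \<subseteq> {..<k}"
  shows "nths xs (- I) \<in> tuples D (k - card I)"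
proof -
  have "{i. i < length xs \<and> i \<in> - I} = {..<k} - I"
    using assms(1) by (auto simp: tuples_def)
  then have "length (nths xs (- I)) = k - card I"
    using assms(2) finite_subset[OF assms(2)] by (simp add: length_nths card_Diff_subset)
  then show ?thesis
    using assms(1) set_nths_subset[of xs "- I"] by (auto simp: tuples_def)
qed

lemma nths_drop_one: "\<lbrakk>xs \<in> tuples D (Suc k); i < Suc k\<rbrakk> \<Longrightarrow> nths xs (- {i}) \<in> tuples D k"
  using nths_Compl_in_tuples[of xs D "Suc k" "{i}"] by simp

lemma nths_drop_two:
  assumes "xs \<in> tuples D (Suc k)" "i < j" "j < Suc k" "d \<in> D"
  shows "d # nths xs (- {i, j}) \<in> tuples D k"
proof -
  have "nths xs (- {i, j}) \<in> tuples D (k - 1)"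
    using nths_Compl_in_tuples[of xs D "Suc k" "{i, j}"] assms by simp
  then show ?thesis
    using assms by (cases k) (simp_all add: tuples_Cons)
qed

lemma nth_tuples: "\<lbrakk>xs \<in> tuples D k; i < k\<rbrakk> \<Longrightarrow> xs ! i \<in> D"
  by (auto simp: tuples_def)

lemma bij_betw_zero_form: "bij_betw zero_form V (alt_forms D scD V scV 0)"
proof (rule bij_betw_byWitness[where f' = "\<lambda>\<omega>. \<omega> []"])
  show "\<forall>\<omega>\<in>alt_forms D scD V scV 0. zero_form (\<omega> []) = \<omega>"
    by (auto simp: alt_forms_def tuples_def zero_form_def fun_eq_iff)
qed (auto simp: alt_forms_def tuples_def zero_form_def)

lemma cartan_d_zero_form: "X \<in> D \<Longrightarrow> cartan_d D 0 (zero_form v) [X] = X v"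
  by (simp add: cartan_d_def tuples_def zero_form_def nths_Compl_0)

lemma signed_Pair: "signed n (0::'a::ab_group_add, v) = (0, signed n v)"
  by (simp add: signed_def)

lemma sum_Pair_0: "(\<Sum>i\<in>I. (0::'a::ab_group_add, f i)) = (0, \<Sum>i\<in>I. f i)"
  by (induction I rule: infinite_finite_induct) (simp_all add: zero_prod_def)

section \<open>Der-operators and derivations of degree 0\<close>

text \<open>
  The pair formed by a Der-operator and one of its symbols. Both sides of the identification are
  images of these pairs, so that closure properties need to be checked only once.
\<close>

definition symbol_pair :: "('k::field_char_0 \<Rightarrow> 'a::comm_ring_1 \<Rightarrow> 'a) \<Rightarrow>
    ('a \<Rightarrow> 'p::ab_group_add \<Rightarrow> 'p) \<Rightarrow> ('a \<Rightarrow> 'a) \<Rightarrow> ('p \<Rightarrow> 'p) \<Rightarrow> bool" where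
  "symbol_pair sK act x \<Delta> \<longleftrightarrow>
     x \<in> derivations sK \<and> Vector_Spaces.linear (scaleP sK act) (scaleP sK act) \<Delta> \<and>
     (\<forall>a p. \<Delta> (act a p) = act (x a) p + act a (\<Delta> p))"

lemma Der_iff: "\<Delta> \<in> Der sK act \<longleftrightarrow> (\<exists>x. symbol_pair sK act x \<Delta>)"
  by (auto simp: Der_def symbol_pair_def)

context diolic_algebra
begin

lemma sK_mult_left: "sK c a * b = sK c (a * b)"
  by (simp add: scale_mult)

lemma sK_mult_right: "a * sK c b = sK c (a * b)"
  using scale_mult[of c b a] by (simp add: mult.commute)

lemma act_scaleP: "act a (scaleP sK act c p) = scaleP sK act c (act a p)"
  by (simp add: scaleP_def mult.commute)

lemma scaleP_diff: "scaleP sK act c (p - q) = scaleP sK act c p - scaleP sK act c q"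
  by (simp add: scaleP_def P.scale_right_diff_distrib)

lemma vector_space_scaleP: "vector_space (scaleP sK act)"
  by unfold_locales
    (simp_all add: scaleP_def P.scale_right_distrib P.scale_left_distrib scale_left_distrib
      sK_mult_left)

lemma vector_space_diolic_scaleK: "vector_space (diolic_scaleK sK act)"
proof -
  interpret S: vector_space "scaleP sK act" by (rule vector_space_scaleP)
  show ?thesis
    by unfold_locales
      (simp_all add: diolic_scaleK_def prod_eq_iff scale_right_distrib scale_left_distrib
        S.scale_right_distrib S.scale_left_distrib)
qed

lemma symbol_pair_iff:
  "symbol_pair sK act x \<Delta> \<longleftrightarrow>
     (\<forall>a b. x (a + b) = x a + x b) \<and> (\<forall>c a. x (sK c a) = sK c (x a)) \<and>
     (\<forall>a b. x (a * b) = x a * b + a * x b) \<and>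
     (\<forall>p q. \<Delta> (p + q) = \<Delta> p + \<Delta> q) \<and>
     (\<forall>c p. \<Delta> (scaleP sK act c p) = scaleP sK act c (\<Delta> p)) \<and>
     (\<forall>a p. \<Delta> (act a p) = act (x a) p + act a (\<Delta> p))"
  using vector_space_axioms vector_space_scaleP
  by (auto simp: symbol_pair_def derivations_def Vector_Spaces.linear_iff)

lemma symbol_pair_add:
  "\<lbrakk>symbol_pair sK act x \<Delta>; symbol_pair sK act y \<Gamma>\<rbrakk> \<Longrightarrow> symbol_pair sK act (x + y) (\<Delta> + \<Gamma>)"
  using vector_space.vector_space_assms(1)[OF vector_space_scaleP]
  by (simp add: symbol_pair_iff algebra_simps scale_right_distrib P.scale_right_distrib
      P.scale_left_distrib)

lemma symbol_pair_scale:
  "symbol_pair sK act x \<Delta> \<Longrightarrow> symbol_pair sK act (\<lambda>b. a * x b) (Der_scale act a \<Delta>)"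
  by (simp add: symbol_pair_iff Der_scale_def algebra_simps sK_mult_right act_scaleP
      P.scale_right_distrib)

lemma symbol_pair_commutator:
  assumes "symbol_pair sK act x \<Delta>" "symbol_pair sK act y \<Gamma>"
  shows "symbol_pair sK act (commutator x y) (commutator \<Delta> \<Gamma>)"
  using assms
  by (simp add: symbol_pair_iff commutator_def algebra_simps scale_right_diff_distrib
      scaleP_diff P.scale_right_diff_distrib P.scale_left_diff_distrib)

lemma der_operators_Der: "der_operators act (Der sK act)"
proof unfold_locales
  show "X + Y \<in> Der sK act" if "X \<in> Der sK act" "Y \<in> Der sK act" for X Y
    using that symbol_pair_add unfolding Der_iff by blast
  show "Der_scale act a X \<in> Der sK act" if "X \<in> Der sK act" for a X
    using that symbol_pair_scale unfolding Der_iff by blast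
  show "commutator X Y \<in> Der sK act" if "X \<in> Der sK act" "Y \<in> Der sK act" for X Y
    using that symbol_pair_commutator unfolding Der_iff by blast
  show "X (p + q) = X p + X q" if "X \<in> Der sK act" for X p q
    using that unfolding Der_iff symbol_pair_iff by blast
  show "\<exists>\<sigma>. \<forall>a p. X (act a p) = act (\<sigma> a) p + act a (X p)" if "X \<in> Der sK act" for X
    using that unfolding Der_iff symbol_pair_iff by blast
qed

lemma map_prod_in_diolic_der0:
  assumes "symbol_pair sK act x \<Delta>"
  shows "map_prod x \<Delta> \<in> diolic_der0 sK act"
proof -
  have x: "x (a + b) = x a + x b" "x (sK c a) = sK c (x a)" "x (a * b) = x a * b + a * x b"
    and \<Delta>: "\<Delta> (p + q) = \<Delta> p + \<Delta> q" "\<Delta> (scaleP sK act c p) = scaleP sK act c (\<Delta> p)"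
      "\<Delta> (act a p) = act (x a) p + act a (\<Delta> p)" for a b c p q
    using assms unfolding symbol_pair_iff by blast+
  have "x 0 = 0" "\<Delta> 0 = 0"
    using x(1)[of 0 0] \<Delta>(1)[of 0 0] by simp_all
  then have "map_prod x \<Delta> ` diolic_comp i \<subseteq> diolic_comp i" for i
    by (auto simp: diolic_comp_def zero_prod_def)
  then show ?thesis
    using vector_space_diolic_scaleK
    by (auto simp: diolic_der0_def Vector_Spaces.linear_iff diolic_scaleK_def diolic_mult_def x \<Delta> prod_eq_iff
        algebra_simps P.scale_right_distrib)
qed

lemma diolic_der0_apply_P:
  assumes "X \<in> diolic_der0 sK act" shows "X (0, p) = (0, to_Der X p)"
proof -
  have "X ` diolic_comp 1 \<subseteq> diolic_comp 1"
    using assms by (simp add: diolic_der0_def)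
  then have "X (0, p) \<in> diolic_comp 1"
    by (auto simp: diolic_comp_def)
  then show ?thesis
    by (simp add: diolic_comp_def to_Der_def mem_Times_iff prod_eq_iff)
qed

text \<open>
  Homogeneity forces a derivation to act separately on \<open>A\<close> and \<open>P\<close>; the Leibniz rule on
  \<open>A \<times> A\<close> makes the first part a derivation, the one on \<open>A \<times> P\<close> makes it the symbol of the second.
\<close>

lemma diolic_der0_cases:
  assumes "X \<in> diolic_der0 sK act"
  obtains x \<Delta> where "symbol_pair sK act x \<Delta>" and "X = map_prod x \<Delta>"
proof -
  define x where "x = (\<lambda>a. fst (X (a, 0)))"
  have lin: "Vector_Spaces.linear (diolic_scaleK sK act) (diolic_scaleK sK act) X"
    and deg: "\<forall>i. X ` diolic_comp i \<subseteq> diolic_comp i"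
    and leibniz: "\<forall>u v. X (diolic_mult act u v) = diolic_mult act (X u) v + diolic_mult act u (X v)"
    using assms unfolding diolic_der0_def by simp_all
  note add = lin[unfolded Vector_Spaces.linear_iff, THEN conjunct2, THEN conjunct2, THEN conjunct1, rule_format]
    and scale = lin[unfolded Vector_Spaces.linear_iff, THEN conjunct2, THEN conjunct2, THEN conjunct2, rule_format]
    and mult = leibniz[rule_format]
  have "X (a, 0) \<in> diolic_comp 0" for a
    using deg[rule_format, of 0] by (auto simp: diolic_comp_def)
  then have X0: "X (a, 0) = (x a, 0)" for a
    by (simp add: diolic_comp_def x_def mem_Times_iff prod_eq_iff)
  have X1: "X (0, p) = (0, to_Der X p)" for p
    by (rule diolic_der0_apply_P[OF assms])
  have "X (a, p) = (x a, to_Der X p)" for a p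
    using add[of "(a, 0)" "(0, p)"] by (simp add: X0 X1)
  then have eq: "X = map_prod x (to_Der X)"
    by (simp add: fun_eq_iff)
  have "symbol_pair sK act x (to_Der X)"
    unfolding symbol_pair_iff
  proof (intro conjI allI)
    show "x (a + b) = x a + x b" for a b
      using add[of "(a, 0)" "(b, 0)"] by (simp add: X0)
    show "x (sK c a) = sK c (x a)" for c a
      using scale[of c "(a, 0)"] by (simp add: X0 diolic_scaleK_def scaleP_def)
    show "x (a * b) = x a * b + a * x b" for a b
      using mult[of "(a, 0)" "(b, 0)"] by (simp add: X0 diolic_mult_def)
    show "to_Der X (p + q) = to_Der X p + to_Der X q" for p q
      using add[of "(0, p)" "(0, q)"] by (simp add: X1)
    show "to_Der X (scaleP sK act c p) = scaleP sK act c (to_Der X p)" for c p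
      using scale[of c "(0, p)"] by (simp add: X1 diolic_scaleK_def)
    show "to_Der X (act a p) = act (x a) p + act a (to_Der X p)" for a p
      using mult[of "(a, 0)" "(0, p)"] by (simp add: X0 X1 diolic_mult_def)
  qed
  then show ?thesis by (rule that[OF _ eq])
qed

lemma to_Der_map_prod: "to_Der (map_prod x \<Delta>) = \<Delta>"
  by (simp add: to_Der_def)

lemma to_Der_image: "to_Der ` diolic_der0 sK act = Der sK act"
proof (intro subset_antisym image_subsetI subsetI)
  fix X assume "X \<in> diolic_der0 sK act"
  then obtain x \<Delta> where x: "symbol_pair sK act x \<Delta>" and X: "X = map_prod x \<Delta>"
    by (rule diolic_der0_cases)
  show "to_Der X \<in> Der sK act"
    unfolding X to_Der_map_prod Der_iff using x by blast
next
  fix \<Delta> assume "\<Delta> \<in> Der sK act"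
  then obtain x where x: "symbol_pair sK act x \<Delta>"
    unfolding Der_iff by blast
  show "\<Delta> \<in> to_Der ` diolic_der0 sK act"
    by (rule image_eqI[where x = "map_prod x \<Delta>"])
      (simp_all add: to_Der_map_prod map_prod_in_diolic_der0[OF x])
qed

lemma to_Der_add: "to_Der (X + Y) = to_Der X + to_Der Y"
  by (simp add: to_Der_def fun_eq_iff)

lemma to_Der_scale:
  assumes "X \<in> diolic_der0 sK act"
  shows "to_Der (diolic_der0_scale act a X) = Der_scale act a (to_Der X)"
proof
  fix p
  have "to_Der (diolic_der0_scale act a X) p = snd (diolic_scale act a (X (0, p)))"
    by (simp add: to_Der_def diolic_der0_scale_def)
  then show "to_Der (diolic_der0_scale act a X) p = Der_scale act a (to_Der X) p"
    unfolding diolic_der0_apply_P[OF assms]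
    by (simp add: Der_scale_def diolic_scale_def diolic_mult_def)
qed

lemma to_Der_commutator:
  assumes "X \<in> diolic_der0 sK act" "Y \<in> diolic_der0 sK act"
  shows "to_Der (commutator X Y) = commutator (to_Der X) (to_Der Y)"
proof
  fix p
  have "to_Der (commutator X Y) p = snd (X (Y (0, p)) - Y (X (0, p)))"
    by (simp add: to_Der_def commutator_def)
  then show "to_Der (commutator X Y) p = commutator (to_Der X) (to_Der Y) p"
    unfolding diolic_der0_apply_P[OF assms(1)] diolic_der0_apply_P[OF assms(2)]
    by (simp add: commutator_def)
qed

lemma diolic_der0_add:
  assumes "X \<in> diolic_der0 sK act" "Y \<in> diolic_der0 sK act"
  shows "X + Y \<in> diolic_der0 sK act"
proof -
  obtain x \<Delta> where x: "symbol_pair sK act x \<Delta>" and X: "X = map_prod x \<Delta>"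
    by (rule diolic_der0_cases[OF assms(1)])
  obtain y \<Gamma> where y: "symbol_pair sK act y \<Gamma>" and Y: "Y = map_prod y \<Gamma>"
    by (rule diolic_der0_cases[OF assms(2)])
  have "X + Y = map_prod (x + y) (\<Delta> + \<Gamma>)"
    unfolding X Y by (simp add: fun_eq_iff)
  then show ?thesis
    using map_prod_in_diolic_der0[OF symbol_pair_add[OF x y]] by (simp only:)
qed

lemma diolic_der0_scale_closed:
  assumes "X \<in> diolic_der0 sK act"
  shows "diolic_der0_scale act a X \<in> diolic_der0 sK act"
proof -
  obtain x \<Delta> where x: "symbol_pair sK act x \<Delta>" and X: "X = map_prod x \<Delta>"
    by (rule diolic_der0_cases[OF assms])
  have "diolic_der0_scale act a X = map_prod (\<lambda>b. a * x b) (Der_scale act a \<Delta>)"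
    unfolding X
    by (simp add: fun_eq_iff diolic_der0_scale_def diolic_scale_def diolic_mult_def Der_scale_def)
  then show ?thesis
    using map_prod_in_diolic_der0[OF symbol_pair_scale[OF x]] by (simp only:)
qed

lemma diolic_der0_commutator:
  assumes "X \<in> diolic_der0 sK act" "Y \<in> diolic_der0 sK act"
  shows "commutator X Y \<in> diolic_der0 sK act"
proof -
  obtain x \<Delta> where x: "symbol_pair sK act x \<Delta>" and X: "X = map_prod x \<Delta>"
    by (rule diolic_der0_cases[OF assms(1)])
  obtain y \<Gamma> where y: "symbol_pair sK act y \<Gamma>" and Y: "Y = map_prod y \<Gamma>"
    by (rule diolic_der0_cases[OF assms(2)])
  have "commutator X Y = map_prod (commutator x y) (commutator \<Delta> \<Gamma>)"
    unfolding X Y by (simp add: fun_eq_iff commutator_def)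
  then show ?thesis
    using map_prod_in_diolic_der0[OF symbol_pair_commutator[OF x y]] by (simp only:)
qed

section \<open>Transport of forms along the identification\<close>

lemma map_to_Der_tuples:
  "Xs \<in> tuples (diolic_der0 sK act) k \<Longrightarrow> map to_Der Xs \<in> tuples (Der sK act) k"
  using to_Der_image by (auto simp: tuples_def)

lemma fat_to_diolic_in_diolic_forms:
  assumes "\<omega> \<in> fat_forms sK act k"
  shows "fat_to_diolic sK act k \<omega> \<in> diolic_forms sK act 1 k"
proof -
  let ?D = "diolic_der0 sK act"
  note \<omega> = alt_formsD[OF assms[unfolded fat_forms_def]]
  have Der: "to_Der X \<in> Der sK act" if "X \<in> ?D" for X
    using that to_Der_image by blast
  show ?thesis
    unfolding diolic_forms_def
  proof (rule alt_formsI)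
    show "fat_to_diolic sK act k \<omega> (Xs[i := X + Y]) =
        fat_to_diolic sK act k \<omega> (Xs[i := X]) + fat_to_diolic sK act k \<omega> (Xs[i := Y])"
      if "Xs \<in> tuples ?D k" "i < k" "X \<in> ?D" "Y \<in> ?D" for Xs i X Y
      using that \<omega>(3)[OF map_to_Der_tuples, of Xs i "to_Der X" "to_Der Y"]
      by (simp add: fat_to_diolic_def tuples_update diolic_der0_add map_update to_Der_add Der)
    show "fat_to_diolic sK act k \<omega> (Xs[i := diolic_der0_scale act a X]) =
        diolic_scale act a (fat_to_diolic sK act k \<omega> (Xs[i := X]))"
      if "Xs \<in> tuples ?D k" "i < k" "X \<in> ?D" for Xs i X a
      using that \<omega>(4)[OF map_to_Der_tuples, of Xs i "to_Der X" a]
      by (simp add: fat_to_diolic_def tuples_update diolic_der0_scale_closed map_update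
          to_Der_scale Der diolic_scale_def diolic_mult_def)
    show "fat_to_diolic sK act k \<omega> Xs = 0"
      if "Xs \<in> tuples ?D k" "i < j" "j < k" "Xs ! i = Xs ! j" for Xs i j
      using that \<omega>(5)[OF map_to_Der_tuples, of Xs i j]
      by (simp add: fat_to_diolic_def tuples_def zero_prod_def)
  qed (auto simp: fat_to_diolic_def diolic_comp_def)
qed

lemma fat_to_diolic_inj: "inj_on (fat_to_diolic sK act k) (fat_forms sK act k)"
proof (rule inj_onI, rule ext)
  fix \<omega> \<omega>' \<Delta>s
  assume \<omega>: "\<omega> \<in> fat_forms sK act k" and \<omega>': "\<omega>' \<in> fat_forms sK act k"
    and eq: "fat_to_diolic sK act k \<omega> = fat_to_diolic sK act k \<omega>'"
  show "\<omega> \<Delta>s = \<omega>' \<Delta>s"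
  proof (cases "\<Delta>s \<in> tuples (Der sK act) k")
    case True
    then have "\<Delta>s \<in> lists (to_Der ` diolic_der0 sK act)"
      using to_Der_image by (auto simp: tuples_def)
    then obtain Xs where "\<Delta>s = map to_Der Xs" "set Xs \<subseteq> diolic_der0 sK act"
      unfolding lists_image by auto
    then show ?thesis
      using True fun_cong[OF eq, of Xs] by (simp add: fat_to_diolic_def tuples_def)
  next
    case False
    then show ?thesis
      using \<omega> \<omega>' by (simp add: fat_forms_def alt_formsD(2))
  qed
qed

text \<open>
  A derivation acts on the component \<open>P\<close> through its Der-operator, and the identification respects
  commutators. Hence the two Cartan formulas agree summand by summand.
\<close>

lemma diolic_d_fat_to_diolic:
  "diolic_d sK act k (fat_to_diolic sK act k \<omega>) = fat_to_diolic sK act (Suc k) (Der_d sK act k \<omega>)"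
proof
  fix Xs
  show "diolic_d sK act k (fat_to_diolic sK act k \<omega>) Xs =
      fat_to_diolic sK act (Suc k) (Der_d sK act k \<omega>) Xs"
  proof (cases "Xs \<in> tuples (diolic_der0 sK act) (Suc k)")
    case True
    have len: "length Xs = Suc k" using True by (simp add: tuples_def)
    have one: "(Xs ! i) (fat_to_diolic sK act k \<omega> (nths Xs (- {i}))) =
        (0, to_Der (Xs ! i) (\<omega> (nths (map to_Der Xs) (- {i}))))" if "i < Suc k" for i
      using that True
      by (simp add: fat_to_diolic_def nths_drop_one nths_map diolic_der0_apply_P[OF nth_tuples])
    have two: "fat_to_diolic sK act k \<omega> (commutator (Xs ! i) (Xs ! j) # nths Xs (- {i, j})) =
        (0, \<omega> (commutator (to_Der (Xs ! i)) (to_Der (Xs ! j)) # nths (map to_Der Xs) (- {i, j})))"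
      if "i < j" "j < Suc k" for i j
    proof -
      have "Xs ! i \<in> diolic_der0 sK act" "Xs ! j \<in> diolic_der0 sK act"
        using nth_tuples[OF True] that by simp_all
      then show ?thesis
        using nths_drop_two[OF True that diolic_der0_commutator]
        by (simp add: fat_to_diolic_def nths_map to_Der_commutator)
    qed
    have "diolic_d sK act k (fat_to_diolic sK act k \<omega>) Xs = (0, Der_d sK act k \<omega> (map to_Der Xs))"
      using True map_to_Der_tuples[OF True] len
      by (simp add: diolic_d_def Der_d_def cartan_d_def one two signed_Pair sum_Pair_0
          del: sum.lessThan_Suc)
    then show ?thesis using True by (simp add: fat_to_diolic_def)
  next
    case False
    then show ?thesis by (simp add: diolic_d_def cartan_d_def fat_to_diolic_def)
  qed
qed

text \<open>
  Here the identification is needed in the direction from Der-operators to derivations. The inverse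
  of \<^const>\<open>to_Der\<close> inherits additivity and homogeneity, so pulling a diolic form back along it gives
  a fat form; values of a form of degree 1 have no component in \<open>A\<close> that could get lost.
\<close>

lemma fat_to_diolic_surj:
  assumes inj: "inj_on to_Der (diolic_der0 sK act)"
    and \<eta>: "\<eta> \<in> diolic_forms sK act 1 k"
  shows "\<eta> \<in> fat_to_diolic sK act k ` fat_forms sK act k"
proof
  let ?D = "diolic_der0 sK act"
  define g where "g = inv_into ?D to_Der"
  define \<omega> where
    "\<omega> = (\<lambda>\<Delta>s. if \<Delta>s \<in> tuples (Der sK act) k then snd (\<eta> (map g \<Delta>s)) else 0)"
  interpret Der: der_operators act "Der sK act" by (rule der_operators_Der)
  have g_in: "g \<Delta> \<in> ?D" and to_g: "to_Der (g \<Delta>) = \<Delta>" if "\<Delta> \<in> Der sK act" for \<Delta>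
    using that by (auto simp: g_def inv_into_into f_inv_into_f simp flip: to_Der_image)
  have g_to: "g (to_Der X) = X" if "X \<in> ?D" for X
    using that inj by (simp add: g_def)
  have g_add: "g (\<Delta> + \<Gamma>) = g \<Delta> + g \<Gamma>" if "\<Delta> \<in> Der sK act" "\<Gamma> \<in> Der sK act" for \<Delta> \<Gamma>
    using g_to[OF diolic_der0_add[OF g_in g_in]] that by (simp add: to_Der_add to_g)
  have g_scale: "g (Der_scale act a \<Delta>) = diolic_der0_scale act a (g \<Delta>)"
    if "\<Delta> \<in> Der sK act" for a \<Delta>
    using g_to[OF diolic_der0_scale_closed[OF g_in]] that by (simp add: to_Der_scale g_in to_g)
  have g_tuples: "map g \<Delta>s \<in> tuples ?D k" if "\<Delta>s \<in> tuples (Der sK act) k" for \<Delta>s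
    using that g_in by (auto simp: tuples_def)
  note \<eta> = alt_formsD[OF \<eta>[unfolded diolic_forms_def]]
  have \<eta>_fst: "fst (\<eta> Xs) = 0" for Xs
    using \<eta>(1,2)[of Xs] by (cases "Xs \<in> tuples ?D k") (auto simp: diolic_comp_def)
  show "\<omega> \<in> fat_forms sK act k"
    unfolding fat_forms_def
  proof (rule alt_formsI)
    show "\<omega> (\<Delta>s[i := \<Delta> + \<Gamma>]) = \<omega> (\<Delta>s[i := \<Delta>]) + \<omega> (\<Delta>s[i := \<Gamma>])"
      if "\<Delta>s \<in> tuples (Der sK act) k" "i < k" "\<Delta> \<in> Der sK act" "\<Gamma> \<in> Der sK act" for \<Delta>s i \<Delta> \<Gamma>
      using that \<eta>(3)[OF g_tuples, of \<Delta>s i "g \<Delta>" "g \<Gamma>"]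
      by (simp add: \<omega>_def tuples_update Der.D_add map_update g_add g_in)
    show "\<omega> (\<Delta>s[i := Der_scale act a \<Delta>]) = act a (\<omega> (\<Delta>s[i := \<Delta>]))"
      if "\<Delta>s \<in> tuples (Der sK act) k" "i < k" "\<Delta> \<in> Der sK act" for \<Delta>s i \<Delta> a
      using that \<eta>(4)[OF g_tuples, of \<Delta>s i "g \<Delta>" a]
      by (simp add: \<omega>_def tuples_update Der.D_scale map_update g_scale g_in diolic_scale_def
          diolic_mult_def \<eta>_fst)
    show "\<omega> \<Delta>s = 0"
      if "\<Delta>s \<in> tuples (Der sK act) k" "i < j" "j < k" "\<Delta>s ! i = \<Delta>s ! j" for \<Delta>s i j
      using that \<eta>(5)[OF g_tuples, of \<Delta>s i j] by (simp add: \<omega>_def tuples_def)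
  qed (simp_all add: \<omega>_def)
  show "\<eta> = fat_to_diolic sK act k \<omega>"
  proof
    show "\<eta> Xs = fat_to_diolic sK act k \<omega> Xs" for Xs
    proof (cases "Xs \<in> tuples ?D k")
      case True
      then have "map (g \<circ> to_Der) Xs = Xs"
        using g_to by (intro map_idI) (auto simp: tuples_def)
      then show ?thesis
        using True by (simp add: fat_to_diolic_def \<omega>_def map_to_Der_tuples prod_eq_iff \<eta>_fst)
    next
      case False
      then show ?thesis using \<eta>(2) by (simp add: fat_to_diolic_def)
    qed
  qed
qed

end

section \<open>The degree 1 diolic de Rham complex\<close>

theorem theorem21:
  fixes sK :: "'k::field_char_0 \<Rightarrow> 'a::comm_ring_1 \<Rightarrow> 'a"
    and act :: "'a \<Rightarrow> 'p::ab_group_add \<Rightarrow> 'p"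
  assumes diolic: "diolic_algebra sK act"
    and identified: "inj_on to_Der (diolic_der0 sK act)"
  shows
    "bij_betw to_Der (diolic_der0 sK act) (Der sK act) \<and>
     (\<forall>X\<in>diolic_der0 sK act. \<forall>Y\<in>diolic_der0 sK act. \<forall>a.
        to_Der (X + Y) = to_Der X + to_Der Y \<and>
        to_Der (diolic_der0_scale act a X) = Der_scale act a (to_Der X) \<and>
        to_Der (commutator X Y) = commutator (to_Der X) (to_Der Y)) \<and>
     bij_betw zero_form (UNIV :: 'p set) (fat_forms sK act 0) \<and>
     (\<forall>p. \<forall>\<Delta>\<in>Der sK act. Der_d sK act 0 (zero_form p) [\<Delta>] = \<Delta> p) \<and>
     bij_betw zero_form (diolic_comp 1) (diolic_forms sK act 1 0) \<and>
     (\<forall>u\<in>diolic_comp 1. \<forall>X\<in>diolic_der0 sK act.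
        diolic_d sK act 0 (zero_form u) [X] = X u) \<and>
     (\<forall>p. fat_to_diolic sK act 0 (zero_form p) = zero_form (0, p)) \<and>
     (\<forall>k. Der_d sK act k ` fat_forms sK act k \<subseteq> fat_forms sK act (Suc k)) \<and>
     (\<forall>k. \<forall>\<omega>\<in>fat_forms sK act k. Der_d sK act (Suc k) (Der_d sK act k \<omega>) = 0) \<and>
     (\<forall>k. diolic_d sK act k ` diolic_forms sK act 1 k \<subseteq> diolic_forms sK act 1 (Suc k)) \<and>
     (\<forall>k. \<forall>\<eta>\<in>diolic_forms sK act 1 k. diolic_d sK act (Suc k) (diolic_d sK act k \<eta>) = 0) \<and>
     (\<forall>k. bij_betw (fat_to_diolic sK act k) (fat_forms sK act k) (diolic_forms sK act 1 k)) \<and>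
     (\<forall>k. \<forall>\<omega>\<in>fat_forms sK act k. \<forall>\<omega>'\<in>fat_forms sK act k. \<forall>a.
        fat_to_diolic sK act k (\<omega> + \<omega>') =
          fat_to_diolic sK act k \<omega> + fat_to_diolic sK act k \<omega>' \<and>
        fat_to_diolic sK act k (\<lambda>\<Delta>s. act a (\<omega> \<Delta>s)) =
          (\<lambda>Xs. diolic_scale act a (fat_to_diolic sK act k \<omega> Xs))) \<and>
     (\<forall>k. \<forall>\<omega>\<in>fat_forms sK act k.
        diolic_d sK act k (fat_to_diolic sK act k \<omega>) =
          fat_to_diolic sK act (Suc k) (Der_d sK act k \<omega>))"
proof -
  interpret diolic_algebra sK act by (rule diolic)
  interpret Der: der_operators act "Der sK act" by (rule der_operators_Der)
  have bij: "bij_betw (fat_to_diolic sK act k) (fat_forms sK act k) (diolic_forms sK act 1 k)" for k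
    unfolding bij_betw_def
    using fat_to_diolic_inj fat_to_diolic_in_diolic_forms fat_to_diolic_surj[OF identified] by blast
  have fat_d: "Der_d sK act k \<omega> \<in> fat_forms sK act (Suc k)"
    and fat_dd: "Der_d sK act (Suc k) (Der_d sK act k \<omega>) = 0"
    if "\<omega> \<in> fat_forms sK act k" for k \<omega>
    using that Der.cartan_d_in_alt_forms Der.cartan_d_cartan_d
    unfolding fat_forms_def Der_d_def by blast+
  have fat_to_diolic_0: "fat_to_diolic sK act k 0 = 0" for k
    by (simp add: fun_eq_iff fat_to_diolic_def zero_prod_def)
  \<comment> \<open>Every diolic form of degree 1 is the image of a fat form, so these properties are transported.\<close>
  have diolic_d: "diolic_d sK act k \<eta> \<in> diolic_forms sK act 1 (Suc k)"
    and diolic_dd: "diolic_d sK act (Suc k) (diolic_d sK act k \<eta>) = 0"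
    if \<eta>: "\<eta> \<in> diolic_forms sK act 1 k" for k \<eta>
  proof -
    obtain \<omega> where \<omega>: "\<omega> \<in> fat_forms sK act k" and eq: "\<eta> = fat_to_diolic sK act k \<omega>"
      using fat_to_diolic_surj[OF identified \<eta>] by blast
    show "diolic_d sK act k \<eta> \<in> diolic_forms sK act 1 (Suc k)"
      unfolding eq diolic_d_fat_to_diolic by (rule fat_to_diolic_in_diolic_forms[OF fat_d[OF \<omega>]])
    show "diolic_d sK act (Suc k) (diolic_d sK act k \<eta>) = 0"
      unfolding eq diolic_d_fat_to_diolic fat_dd[OF \<omega>] by (rule fat_to_diolic_0)
  qed
  show ?thesis
  proof (intro conjI allI ballI)
    show "bij_betw to_Der (diolic_der0 sK act) (Der sK act)"
      using identified to_Der_image by (simp add: bij_betw_def)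
    show "bij_betw zero_form (UNIV :: 'p set) (fat_forms sK act 0)"
      unfolding fat_forms_def by (rule bij_betw_zero_form)
    show "bij_betw zero_form (diolic_comp 1) (diolic_forms sK act 1 0)"
      unfolding diolic_forms_def by (rule bij_betw_zero_form)
    show "fat_to_diolic sK act 0 (zero_form p) = zero_form (0, p)" for p
      by (auto simp: fun_eq_iff fat_to_diolic_def zero_form_def tuples_def)
    show "Der_d sK act k ` fat_forms sK act k \<subseteq> fat_forms sK act (Suc k)" for k
      using fat_d by blast
    show "diolic_d sK act k ` diolic_forms sK act 1 k \<subseteq> diolic_forms sK act 1 (Suc k)" for k
      using diolic_d by blast
    show "fat_to_diolic sK act k (\<omega> + \<omega>') =
        fat_to_diolic sK act k \<omega> + fat_to_diolic sK act k \<omega>'" for k \<omega> \<omega>'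
      by (simp add: fun_eq_iff fat_to_diolic_def)
    show "fat_to_diolic sK act k (\<lambda>\<Delta>s. act a (\<omega> \<Delta>s)) =
        (\<lambda>Xs. diolic_scale act a (fat_to_diolic sK act k \<omega> Xs))" for k \<omega> a
      by (simp add: fun_eq_iff fat_to_diolic_def diolic_scale_def diolic_mult_def zero_prod_def)
  qed (simp_all add: to_Der_add to_Der_scale to_Der_commutator fat_dd diolic_dd bij
      diolic_d_fat_to_diolic Der_d_def[of _ _ 0] diolic_d_def[of _ _ 0] cartan_d_zero_form)
qed


end
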